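(* Let $\alpha>0$ and let $\{Z_i,i\in\mathbb{Z}\}$ be i.i.d. positive random variables with finite mean $\mu$; set $\psi(t)=\mathbb{P}(Z_i>t)$. 1. If $\mathbb{E}[e^{Z_1^\alpha}]<\infty$, then $\mathrm{gap}(L)\sim L^{-2}$, $\mathbb{P}$-a.s.; that is, there exist constants $c_1,c_2>0$ such that $$c_1L^{-2}\le\mathrm{gap}(L)\le c_2L^{-2},\qquad\mathbb{P}\text{-a.s.}$$ 2. Let $b:\mathbb{R}_+\to\mathbb{R}_+$ be a nonnegative, nondecreasing function such that $\psi(b(n))\to0$ and $n\psi(b(n))\to\infty$ as $n\to\infty$, and $\sum_{n\in\mathbb{N}}\psi(b(n))e^{-n\psi(b(n))}<\infty$. Then, for any $\gamma\in(0,1)$, there exists a positive constant $C=C(\gamma)<\infty$ such that $$\mathrm{gap}(L)\le C(\log L)^2\,\frac{e^{-d(\alpha)\,b(\gamma L/\mu)^\alpha}}{L},\qquad\mathbb{P}\text{-a.s.},$$ where $d(\alpha)=1\wedge3^{\alpha-1}$. If $\mathbb{P}(Z_i\le\delta)=0$ for some $\delta>0$, the last estimate holds without the logarithmic correction (i.e. without the factor $(\log L)^2$).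
   Context: $\xi=\{x_k\}_{k\in\mathbb{Z}}$ is the renewal point process with $x_0=0$, $x_k=x_{k-1}+Z_{k-1}$; $\mathbb{P},\mathbb{E}$ are its law and expectation. For $L>0$: $\xi_L=\xi\cap[-L/2,L/2]$, and $\#(\xi_L)$ is its number of points. The Poincaré constant is $$\gamma(L)=\gamma(L,\xi)=\sup_{f:\xi_L\to\mathbb{R}}\frac1{\#(\xi_L)}\,\frac{\sum_{x,y\in\xi_L}(f(x)-f(y))^2}{\sum_{x,y\in\xi_L}e^{-|x-y|^\alpha}(f(x)-f(y))^2}$$ (supremum over nonconstant $f$), and the spectral gap is $\mathrm{gap}(L)=\gamma(L)^{-1}$. Equivalently, $\mathrm{gap}(L)$ is the smallest nonzero eigenvalue of $-\mathcal{L}_L$, where $\mathcal{L}_Lf(x)=\sum_{y\in\xi_L}e^{-|x-y|^\alpha}(f(y)-f(x))$, $x\in\xi_L$. Here $b(t)^\alpha$ means $(b(t))^\alpha$. Convention: an assertion depending on $L$ holds "$\mathbb{P}$-a.s." if with $\mathbb{P}$-probability $1$ there is $L_0=L_0(\xi)<\infty$ such that it holds for all $L\in\mathbb{N}$ with $L\ge L_0$. Constants are deterministic. *)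

theory Defs
  imports "HOL-Probability.Probability"
begin

text \<open>The two-sided renewal sequence with \<open>x 0 = 0\<close> and \<open>x k = x (k - 1) + z (k - 1)\<close>
  for every integer \<open>k\<close> (see \<open>renewal_point_rec\<close>).\<close>

definition renewal_point :: "(int \<Rightarrow> real) \<Rightarrow> int \<Rightarrow> real" where
  "renewal_point z k =
     (if 0 \<le> k then (\<Sum>i\<in>{0..<k}. z i) else - (\<Sum>i\<in>{k..<0}. z i))"

lemma renewal_point_0: "renewal_point z 0 = 0"
  by (simp add: renewal_point_def)

lemma renewal_point_rec: "renewal_point z k = renewal_point z (k - 1) + z (k - 1)"
proof (cases "1 \<le> k")
  case True
  then have "{0..<k} = insert (k - 1) {0..<k - 1}" by auto
  with True show ?thesis by (simp add: renewal_point_def)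
next
  case False
  then have "{k - 1..<0} = insert (k - 1) {k..<0}" by auto
  with False show ?thesis by (cases "k = 0") (simp_all add: renewal_point_def)
qed

definition renewal_set :: "(int \<Rightarrow> real) \<Rightarrow> real set" where
  "renewal_set z = range (renewal_point z)"

definition box_points :: "real set \<Rightarrow> real \<Rightarrow> real set" where
  "box_points \<xi> L = \<xi> \<inter> {- L / 2..L / 2}"

text \<open>A test function on \<open>box_points \<xi> L\<close> is represented by a function on all of \<open>real\<close>, of
  which only the values on \<open>box_points \<xi> L\<close> matter. If \<open>box_points \<xi> L\<close> is finite with at
  least two points (almost surely the case for all large \<open>L\<close> for a renewal set), the set of
  quotients below is nonempty, and bounded above by \<open>exp (L powr \<alpha>) / card (box_points \<xi> L)\<close>
  when \<open>\<alpha> > 0\<close>, so that the supremum in the reals is a genuine one.\<close>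

definition poincare_const :: "real \<Rightarrow> real set \<Rightarrow> real \<Rightarrow> real" where
  "poincare_const \<alpha> \<xi> L =
     (let X = box_points \<xi> L in
      SUP f \<in> {f :: real \<Rightarrow> real. \<not> f constant_on X}.
        1 / real (card X) *
        ((\<Sum>x\<in>X. \<Sum>y\<in>X. (f x - f y)\<^sup>2) /
         (\<Sum>x\<in>X. \<Sum>y\<in>X. exp (- (\<bar>x - y\<bar> powr \<alpha>)) * (f x - f y)\<^sup>2)))"

definition spectral_gap :: "real \<Rightarrow> real set \<Rightarrow> real \<Rightarrow> real" where
  "spectral_gap \<alpha> \<xi> L = inverse (poincare_const \<alpha> \<xi> L)"

end

theory Submission
  imports Defs "HOL-Real_Asymp.Real_Asymp" "HOL-Library.Nat_Bijection"
begin

text \<open>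
  The gap is the infimum over test functions \<open>f\<close> of \<open>n E(f) / V(f)\<close>, where \<open>n\<close> is the number of points in
  the box, \<open>E(f)\<close> is the sum of \<open>exp (- \<bar>x - y\<bar>\<^sup>\<alpha>) (f x - f y)\<^sup>2\<close> over all ordered pairs and \<open>V(f)\<close> is the
  same sum without the rates. Upper bounds come from single test functions, lower bounds from an
  inequality between \<open>V\<close> and \<open>E\<close>.

  Lower bound \<open>L\<^sup>-\<^sup>2\<close> (\<open>gap_ge_inverse_square\<close>). Cauchy-Schwarz along the nearest-neighbour path bounds
  \<open>V\<close> by \<open>n\<^sup>2 R E\<close>, with \<open>R\<close> the sum of \<open>exp (Z\<^sub>k\<^sup>\<alpha>)\<close> over the spacings in the box
  (\<open>spectral_gap_ge_path\<close>). Under the exponential moment \<open>R\<close> and \<open>n\<close> are at most of order \<open>L\<close>.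

  Upper bound \<open>L\<^sup>-\<^sup>2\<close> (\<open>gap_le_inverse_square\<close>). The test function \<open>x\<^sub>k \<mapsto> k\<close> has \<open>V\<close> of order \<open>L\<^sup>4\<close>. Its
  energy is the sum over the starting points \<open>k\<close> of the functional
  \<open>\<Sum>\<^sub>d d\<^sup>2 exp (- (x\<^sub>k\<^sub>+\<^sub>d - x\<^sub>k)\<^sup>\<alpha>)\<close> of the shifted environment. This functional is integrable by a
  Chernoff bound, so the energy is at most of order \<open>L\<close>. The ergodic theorem is used here in the one-sided form
  \<open>iid_ergodic_upper\<close>, which also supplies all laws of large numbers: the maximal ergodic argument
  gives a contradiction on the event that centred partial sums are unbounded, and this event is
  trivial by the 0-1 law. The two half-lines are treated separately, and the jumps over the origin
  have finite total energy.

  Upper bound through a large spacing (\<open>gap_le_of_windows\<close>). The summability condition on \<open>b\<close> ensures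
  that almost surely the largest of \<open>n\<close> spacings eventually exceeds \<open>b n\<close> (\<open>iid_max_exceeds\<close>). Apply
  this to the \<open>\<gamma> L / \<mu>\<close> spacings closest to the origin, which lie well inside the box, and take for \<open>f\<close>
  the indicator of the points to the right of that spacing (\<open>spectral_gap_le_cut\<close>). Then \<open>V / n\<close> is at least of
  order \<open>L\<close>, and superadditivity of the power up to the constant \<open>d(\<alpha>)\<close> splits \<open>E\<close> into
  \<open>exp (- d(\<alpha>) b\<^sup>\<alpha>)\<close> and one sum for each side of the cut. Each of these sums is at most of the order of the longest run
  of spacings below some level \<open>\<delta>\<close>: logarithmic in \<open>L\<close> in general (\<open>log_windows\<close>), and trivial if the
  spacings are bounded below.
\<close>

section \<open>Partial sums along an i.i.d. sequence\<close>

text \<open>The running maximum of the partial sums of \<open>F\<close> along the shift, starting from the empty sum. The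
  recursion peels off the first summand instead of adding a last one, because the argument below
  compares the maximum for a sequence with the maximum for the shifted sequence.\<close>

fun shift_max :: "((nat \<Rightarrow> real) \<Rightarrow> real) \<Rightarrow> nat \<Rightarrow> (nat \<Rightarrow> real) \<Rightarrow> real" where
  "shift_max F 0 z = 0"
| "shift_max F (Suc n) z = max 0 (F z + shift_max F n (\<lambda>i. z (Suc i)))"

definition shift_sum :: "((nat \<Rightarrow> real) \<Rightarrow> real) \<Rightarrow> nat \<Rightarrow> (nat \<Rightarrow> real) \<Rightarrow> real" where
  "shift_sum F n z = (\<Sum>k<n. F (\<lambda>i. z (i + k)))"

lemma shift_sum_Suc: "shift_sum F (Suc n) z = F z + shift_sum F n (\<lambda>i. z (Suc i))"
  unfolding shift_sum_def by (subst sum.lessThan_Suc_shift) simp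

lemma shift_max_nonneg: "0 \<le> shift_max F n z"
  by (cases n) auto

lemma shift_max_mono: "shift_max F n z \<le> shift_max F (Suc n) z"
proof (induction n arbitrary: z)
  case (Suc n)
  have "F z + shift_max F n (\<lambda>i. z (Suc i)) \<le> F z + shift_max F (Suc n) (\<lambda>i. z (Suc i))"
    using Suc by (rule add_left_mono)
  then show ?case by (subst (1 2) shift_max.simps) (rule max.mono[OF order_refl])
qed simp

lemma shift_sum_le_shift_max: "shift_sum F n z \<le> shift_max F n z"
proof (induction n arbitrary: z)
  case (Suc n)
  show ?case using Suc[of "\<lambda>i. z (Suc i)"] by (simp add: shift_sum_Suc)
qed (simp add: shift_sum_def)

lemma measurable_reindex:
  "(\<lambda>z i. z (f i)) \<in> measurable (\<Pi>\<^sub>M i\<in>(UNIV::nat set). borel :: real measure) (\<Pi>\<^sub>M i\<in>(UNIV::nat set). borel)"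
  by (rule measurable_PiM_single') (auto simp: space_PiM)

lemma shift_max_measurable [measurable]:
  assumes [measurable]: "F \<in> borel_measurable (\<Pi>\<^sub>M i\<in>UNIV. borel)"
  shows "shift_max F n \<in> borel_measurable (\<Pi>\<^sub>M i\<in>UNIV. borel)"
proof (induction n)
  case 0
  have "shift_max F 0 = (\<lambda>_. 0)" by auto
  then show ?case by simp
next
  case (Suc n)
  have "(\<lambda>z. shift_max F n (\<lambda>i. z (Suc i))) \<in> borel_measurable (\<Pi>\<^sub>M i\<in>UNIV. borel)"
    by (rule measurable_compose[OF measurable_reindex Suc])
  then have "(\<lambda>z. max 0 (F z + shift_max F n (\<lambda>i. z (Suc i)))) \<in> borel_measurable (\<Pi>\<^sub>M i\<in>UNIV. borel)"
    by (intro borel_measurable_max borel_measurable_add borel_measurable_const assms)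
  moreover have "shift_max F (Suc n) = (\<lambda>z. max 0 (F z + shift_max F n (\<lambda>i. z (Suc i))))"
    by (rule ext) (rule shift_max.simps)
  ultimately show ?case by (rule ssubst[rotated])
qed

lemma shift_sum_measurable [measurable]:
  assumes [measurable]: "F \<in> borel_measurable (\<Pi>\<^sub>M i\<in>UNIV. borel)"
  shows "shift_sum F n \<in> borel_measurable (\<Pi>\<^sub>M i\<in>UNIV. borel)"
  unfolding shift_sum_def by (intro borel_measurable_sum measurable_compose[OF measurable_reindex assms])

definition (in prob_space) iid :: "('i \<Rightarrow> 'a \<Rightarrow> real) \<Rightarrow> bool" where
  "iid X \<longleftrightarrow> indep_vars (\<lambda>_. borel) X UNIV \<and> (\<forall>i j. distr M borel (X i) = distr M borel (X j))"

lemma (in prob_space) iid_rv: "iid X \<Longrightarrow> random_variable borel (X i)"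
  unfolding iid_def indep_vars_def by auto

lemma (in prob_space) iid_seq_measurable:
  assumes "iid (X :: nat \<Rightarrow> 'a \<Rightarrow> real)"
  shows "(\<lambda>\<omega> i. X (f i) \<omega>) \<in> measurable M (\<Pi>\<^sub>M i\<in>(UNIV::nat set). borel)"
  using iid_rv[OF assms] by (intro measurable_PiM_single') (auto simp: space_PiM)

lemma (in prob_space) iid_reindex:
  fixes X :: "'i \<Rightarrow> 'a \<Rightarrow> real"
  assumes X: "iid X" and f: "inj f"
  shows "iid (\<lambda>i. X (f i))"
proof -
  have I: "indep_sets (\<lambda>i. sigma_sets (space M) {X i -` A \<inter> space M |A. A \<in> sets borel}) UNIV"
    and rv: "\<And>i. random_variable borel (X i)"
    using X unfolding iid_def indep_vars_def by auto
  let ?G = "\<lambda>i. sigma_sets (space M) {X i -` A \<inter> space M |A. A \<in> sets borel}"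
  have "indep_sets (\<lambda>i. ?G (f i)) UNIV"
  proof (rule indep_setsI)
    show "?G (f i) \<subseteq> events" for i using I unfolding indep_sets_def by auto
    fix A J assume J: "J \<noteq> {}" "J \<subseteq> UNIV" "finite J" "\<forall>j\<in>J. A j \<in> ?G (f j)"
    have "prob (\<Inter>j\<in>f ` J. A (inv f j)) = (\<Prod>j\<in>f ` J. prob (A (inv f j)))"
      using J f by (intro indep_setsD[OF I]) auto
    then show "prob (\<Inter>j\<in>J. A j) = (\<Prod>j\<in>J. prob (A j))"
      using f by (simp add: prod.reindex inj_on_def)
  qed
  then show ?thesis using X rv unfolding iid_def indep_vars_def by auto
qed

text \<open>Both laws are the infinite product of the common one-coordinate law.\<close>

lemma (in prob_space) iid_law_shift:
  fixes X :: "nat \<Rightarrow> 'a \<Rightarrow> real"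
  assumes X: "iid X"
  shows "distr M (\<Pi>\<^sub>M i\<in>UNIV. borel) (\<lambda>\<omega> i. X (i + n) \<omega>)
       = distr M (\<Pi>\<^sub>M i\<in>UNIV. borel) (\<lambda>\<omega> i. X i \<omega>)"
proof -
  have *: "distr M (\<Pi>\<^sub>M i\<in>UNIV. borel) (\<lambda>\<omega> i. Y i \<omega>) = (\<Pi>\<^sub>M i\<in>UNIV. distr M borel (Y i))"
    if "iid Y" for Y :: "nat \<Rightarrow> 'a \<Rightarrow> real"
    using indep_vars_iff_distr_eq_PiM[of UNIV Y "\<lambda>_. borel"] iid_rv[OF that] that
    unfolding iid_def by (simp add: restrict_UNIV)
  have "iid (\<lambda>i. X (i + n))" by (rule iid_reindex[OF X]) (auto simp: inj_def)
  note *[OF this]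
  also have "(\<lambda>i. distr M borel (X (i + n))) = (\<lambda>i. distr M borel (X i))"
    using X by (auto simp: iid_def)
  also note *[OF X, symmetric]
  finally show ?thesis .
qed

lemma (in prob_space)
  fixes X :: "nat \<Rightarrow> 'a \<Rightarrow> real"
  assumes X: "iid X" and [measurable]: "G \<in> borel_measurable (\<Pi>\<^sub>M i\<in>UNIV. borel)"
  shows iid_integrable_shift: "integrable M (\<lambda>\<omega>. G (\<lambda>i. X (i + n) \<omega>)) \<longleftrightarrow> integrable M (\<lambda>\<omega>. G (\<lambda>i. X i \<omega>))"
    and iid_integral_shift: "expectation (\<lambda>\<omega>. (G (\<lambda>i. X (i + n) \<omega>) :: real)) = expectation (\<lambda>\<omega>. G (\<lambda>i. X i \<omega>))"
proof -
  note m = iid_seq_measurable[OF X, of "\<lambda>i. i + n"] iid_seq_measurable[OF X, of "\<lambda>i. i"]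
  show "integrable M (\<lambda>\<omega>. G (\<lambda>i. X (i + n) \<omega>)) \<longleftrightarrow> integrable M (\<lambda>\<omega>. G (\<lambda>i. X i \<omega>))"
    using integrable_distr_eq[OF m(1) assms(2)] integrable_distr_eq[OF m(2) assms(2)]
    by (simp only: iid_law_shift[OF X])
  show "expectation (\<lambda>\<omega>. G (\<lambda>i. X (i + n) \<omega>)) = expectation (\<lambda>\<omega>. G (\<lambda>i. X i \<omega>))"
    using integral_distr[OF m(1) assms(2)] integral_distr[OF m(2) assms(2)]
    by (simp only: iid_law_shift[OF X])
qed

definition unbounded_shift_sums :: "((nat \<Rightarrow> real) \<Rightarrow> real) \<Rightarrow> (nat \<Rightarrow> real) \<Rightarrow> bool" where
  "unbounded_shift_sums F z \<longleftrightarrow> (\<forall>B::nat. \<exists>n. shift_sum F n z > real B)"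

text \<open>Removing the first summand changes every partial sum by the same finite amount. This is what
  makes unboundedness a tail event.\<close>

lemma unbounded_shift_sums_step:
  "unbounded_shift_sums F (\<lambda>i. z (Suc i)) \<longleftrightarrow> unbounded_shift_sums F z"
proof
  assume *: "unbounded_shift_sums F (\<lambda>i. z (Suc i))"
  show "unbounded_shift_sums F z" unfolding unbounded_shift_sums_def
  proof
    fix B :: nat
    obtain B' :: nat where "real B - F z \<le> B'" using real_arch_simple by blast
    moreover obtain n where "shift_sum F n (\<lambda>i. z (Suc i)) > B'"
      using * unfolding unbounded_shift_sums_def by blast
    ultimately show "\<exists>n. shift_sum F n z > B" by (intro exI[of _ "Suc n"]) (simp add: shift_sum_Suc)
  qed
next
  assume *: "unbounded_shift_sums F z"
  show "unbounded_shift_sums F (\<lambda>i. z (Suc i))" unfolding unbounded_shift_sums_def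
  proof
    fix B :: nat
    obtain B' :: nat where B': "real B + F z \<le> B'" using real_arch_simple by blast
    obtain n where n: "shift_sum F n z > B'"
      using * unfolding unbounded_shift_sums_def by blast
    then obtain k where "n = Suc k" by (cases n) (auto simp: shift_sum_def)
    with n B' show "\<exists>n. shift_sum F n (\<lambda>i. z (Suc i)) > B" by (auto intro!: exI[of _ k] simp: shift_sum_Suc)
  qed
qed

lemma unbounded_shift_sums_shift:
  "unbounded_shift_sums F (\<lambda>i. z (i + m)) \<longleftrightarrow> unbounded_shift_sums F z"
  using unbounded_shift_sums_step[of F "\<lambda>i. z (i + _)"] by (induction m) auto

lemma unbounded_shift_sums_measurable [measurable]:
  assumes [measurable]: "F \<in> borel_measurable (\<Pi>\<^sub>M i\<in>UNIV. borel)"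
  shows "Measurable.pred (\<Pi>\<^sub>M i\<in>UNIV. borel) (unbounded_shift_sums F)"
  unfolding unbounded_shift_sums_def by measurable

text \<open>With \<open>M\<^sub>n\<close> the running maximum and \<open>M'\<^sub>n\<close> the same quantity for the shifted sequence,
  stationarity gives \<open>0 = E (M\<^sub>n - M'\<^sub>n) \<le> E (M\<^sub>n\<^sub>+\<^sub>1 - M'\<^sub>n)\<close>, and by the recursion the last integrand is
  \<open>max (- M'\<^sub>n) F\<close>. If the partial sums are unbounded then \<open>M'\<^sub>n\<close> tends to infinity, the integrand
  tends to \<open>F\<close>, and it is dominated by \<open>\<bar>F\<bar>\<close> because \<open>M'\<^sub>n\<close> is nonnegative.\<close>

lemma (in prob_space) maximal_ergodic:
  fixes X :: "nat \<Rightarrow> 'a \<Rightarrow> real"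
  assumes X: "iid X" and F[measurable]: "F \<in> borel_measurable (\<Pi>\<^sub>M i\<in>UNIV. borel)"
    and int: "integrable M (\<lambda>\<omega>. F (\<lambda>i. X i \<omega>))"
    and unb: "AE \<omega> in M. unbounded_shift_sums F (\<lambda>i. X i \<omega>)"
  shows "0 \<le> expectation (\<lambda>\<omega>. F (\<lambda>i. X i \<omega>))"
proof -
  note [measurable] = iid_seq_measurable[OF X, of "Suc"] iid_seq_measurable[OF X, of "\<lambda>i. i"]
  define Y where "Y = (\<lambda>\<omega> i. X i \<omega>)"
  define Y' where "Y' = (\<lambda>\<omega> i. X (Suc i) \<omega>)"
  note shift = iid_integrable_shift[OF X, of _ 1] iid_integral_shift[OF X, of _ 1]
  have [measurable]: "Y \<in> measurable M (\<Pi>\<^sub>M i\<in>UNIV. borel)" "Y' \<in> measurable M (\<Pi>\<^sub>M i\<in>UNIV. borel)"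
    unfolding Y_def Y'_def by measurable
  have step: "shift_max F (Suc n) (Y \<omega>) = max 0 (F (Y \<omega>) + shift_max F n (Y' \<omega>))" for n \<omega>
    by (simp add: Y_def Y'_def)
  have iF: "integrable M (\<lambda>\<omega>. F (Y \<omega>))" using int by (simp add: Y_def)
  have iS: "integrable M (\<lambda>\<omega>. shift_max F n (Y' \<omega>)) \<longleftrightarrow> integrable M (\<lambda>\<omega>. shift_max F n (Y \<omega>))"
    "expectation (\<lambda>\<omega>. shift_max F n (Y' \<omega>)) = expectation (\<lambda>\<omega>. shift_max F n (Y \<omega>))" for n
    using shift[of "shift_max F n"] by (simp_all add: Y_def Y'_def)
  have i: "integrable M (\<lambda>\<omega>. shift_max F n (Y \<omega>))" for n
  proof (induction n)
    case (Suc n)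
    then show ?case unfolding step using iF iS(1) by (intro integrable_max) auto
  qed simp
  have i': "integrable M (\<lambda>\<omega>. shift_max F n (Y' \<omega>))" for n using i iS by simp
  define g where "g = (\<lambda>n \<omega>. max (- shift_max F n (Y' \<omega>)) (F (Y \<omega>)))"
  have ge: "0 \<le> expectation (g n)" for n
  proof -
    have "0 = expectation (\<lambda>\<omega>. shift_max F n (Y \<omega>)) - expectation (\<lambda>\<omega>. shift_max F n (Y' \<omega>))"
      using iS by simp
    also have "\<dots> = expectation (\<lambda>\<omega>. shift_max F n (Y \<omega>) - shift_max F n (Y' \<omega>))"
      using i i' by simp
    also have "\<dots> \<le> expectation (g n)"
      unfolding g_def
    proof (intro integral_mono)
      show "shift_max F n (Y \<omega>) - shift_max F n (Y' \<omega>) \<le> max (- shift_max F n (Y' \<omega>)) (F (Y \<omega>))" for \<omega>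
        using shift_max_mono[of F n "Y \<omega>"] unfolding step by linarith
    qed (use i i' iF in auto)
    finally show ?thesis .
  qed
  have "(\<lambda>n. expectation (g n)) \<longlonglongrightarrow> expectation (\<lambda>\<omega>. F (Y \<omega>))"
  proof (rule integral_dominated_convergence[where w = "\<lambda>\<omega>. \<bar>F (Y \<omega>)\<bar>"])
    show "AE \<omega> in M. norm (g n \<omega>) \<le> \<bar>F (Y \<omega>)\<bar>" for n
    proof (rule AE_I2)
      fix \<omega> show "norm (g n \<omega>) \<le> \<bar>F (Y \<omega>)\<bar>"
        using shift_max_nonneg[of F n "Y' \<omega>"] unfolding g_def by (auto simp: max_def)
    qed
    show "AE \<omega> in M. (\<lambda>n. g n \<omega>) \<longlonglongrightarrow> F (Y \<omega>)" using unb
    proof eventually_elim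
      case (elim \<omega>)
      then have "unbounded_shift_sums F (Y' \<omega>)" unfolding Y'_def using unbounded_shift_sums_step[of F "\<lambda>i. X i \<omega>"] by simp
      moreover obtain B :: nat where "- F (Y \<omega>) \<le> B" using real_arch_simple by blast
      ultimately obtain N where "- F (Y \<omega>) < shift_sum F N (Y' \<omega>)"
        unfolding unbounded_shift_sums_def by (meson le_less_trans)
      then have N: "- F (Y \<omega>) < shift_max F N (Y' \<omega>)" using shift_sum_le_shift_max less_le_trans by blast
      have "eventually (\<lambda>n. g n \<omega> = F (Y \<omega>)) sequentially"
        unfolding eventually_sequentially
      proof (intro exI allI impI)
        fix n assume "N \<le> n"
        then have "shift_max F N (Y' \<omega>) \<le> shift_max F n (Y' \<omega>)"
          by (rule lift_Suc_mono_le[where f = "\<lambda>n. shift_max F n (Y' \<omega>)", OF shift_max_mono])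
        with N show "g n \<omega> = F (Y \<omega>)" unfolding g_def by simp
      qed
      then show ?case by (rule tendsto_eventually)
    qed
  qed (use iF in \<open>auto simp: g_def\<close>)
  from LIMSEQ_le_const[OF this, of 0] ge show ?thesis by (auto simp: Y_def)
qed

text \<open>The event is unchanged by any finite shift, so it is measurable with respect to the coordinates
  from any index on, although \<open>F\<close> itself may depend on all coordinates.\<close>

lemma (in prob_space) unbounded_shift_sums_0_1:
  fixes X :: "nat \<Rightarrow> 'a \<Rightarrow> real"
  assumes X: "iid X" and F[measurable]: "F \<in> borel_measurable (\<Pi>\<^sub>M i\<in>UNIV. borel)"
  defines "E \<equiv> {\<omega> \<in> space M. unbounded_shift_sums F (\<lambda>i. X i \<omega>)}"
  shows "prob E = 0 \<or> prob E = 1"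
proof (rule kolmogorov_0_1_law)
  let ?A = "\<lambda>i. sigma_sets (space M) {X i -` A \<inter> space M |A. A \<in> sets borel}"
  have A: "?A i \<subseteq> Pow (space M)" for i
    by (intro subsetI PowI sigma_sets_into_sp) auto
  show "sigma_algebra (space M) (?A i)" for i by (rule sigma_algebra_sigma_sets) auto
  show "indep_sets ?A UNIV" using X unfolding iid_def indep_vars_def by simp
  show "E \<in> tail_events ?A" unfolding tail_events_def
  proof
    fix m
    let ?U = "\<Union> (?A ` {m..})"
    let ?N = "sigma (space M) ?U"
    have U: "?U \<subseteq> Pow (space M)" using A by blast
    have "X (i + m) \<in> borel_measurable ?N" for i
    proof (rule measurableI)
      fix B :: "real set" assume "B \<in> sets borel"
      then have "X (i + m) -` B \<inter> space M \<in> ?A (i + m)" by auto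
      moreover have "?A (i + m) \<subseteq> ?U" by (rule UN_upper) simp
      ultimately have "X (i + m) -` B \<inter> space M \<in> ?U" by blast
      then show "X (i + m) -` B \<inter> space ?N \<in> sets ?N" using U by (simp add: sets_measure_of)
    qed auto
    then have [measurable]: "(\<lambda>\<omega> i. X (i + m) \<omega>) \<in> measurable ?N (\<Pi>\<^sub>M i\<in>UNIV. borel)"
      by (intro measurable_PiM_single') (auto simp: space_PiM)
    have "{\<omega> \<in> space ?N. unbounded_shift_sums F (\<lambda>i. X (i + m) \<omega>)} \<in> sets ?N" by measurable
    then show "E \<in> sigma_sets (space M) ?U"
      using U unbounded_shift_sums_shift[of F "\<lambda>i. X i _" m] by (simp add: E_def)
  qed
qed

text \<open>The upper half of the ergodic theorem for the Bernoulli shift, which contains the strong law of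
  large numbers (for \<open>F\<close> and \<open>- F\<close> reading off one coordinate). For \<open>e\<close> strictly between the mean
  and \<open>c\<close> the function \<open>F - e\<close> has negative mean, so its partial sums cannot be almost surely
  unbounded; by the 0-1 law they are almost surely bounded, and a bounded error is absorbed by
  \<open>(c - e) n\<close>.\<close>

lemma (in prob_space) iid_ergodic_upper:
  fixes X :: "nat \<Rightarrow> 'a \<Rightarrow> real"
  assumes X: "iid X" and F[measurable]: "F \<in> borel_measurable (\<Pi>\<^sub>M i\<in>UNIV. borel)"
    and int: "integrable M (\<lambda>\<omega>. F (\<lambda>i. X i \<omega>))"
    and c: "expectation (\<lambda>\<omega>. F (\<lambda>i. X i \<omega>)) < c"
  shows "AE \<omega> in M. \<forall>\<^sub>F n in sequentially. (\<Sum>k<n. F (\<lambda>i. X (i + k) \<omega>)) \<le> c * real n"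
proof -
  obtain e where e: "expectation (\<lambda>\<omega>. F (\<lambda>i. X i \<omega>)) < e" "e < c" using c dense by blast
  let ?G = "\<lambda>z. F z - e"
  note [measurable] = iid_seq_measurable[OF X, of "\<lambda>i. i"]
  let ?E = "{\<omega> \<in> space M. unbounded_shift_sums ?G (\<lambda>i. X i \<omega>)}"
  have "\<not> (AE \<omega> in M. unbounded_shift_sums ?G (\<lambda>i. X i \<omega>))"
  proof
    assume "AE \<omega> in M. unbounded_shift_sums ?G (\<lambda>i. X i \<omega>)"
    from maximal_ergodic[OF X _ _ this] int have "0 \<le> expectation (\<lambda>\<omega>. ?G (\<lambda>i. X i \<omega>))" by simp
    then show False using e int by (simp add: prob_space)
  qed
  then have "prob ?E \<noteq> 1" using prob_Collect_eq_1[of "\<lambda>\<omega>. unbounded_shift_sums ?G (\<lambda>i. X i \<omega>)"] by auto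
  then have "prob ?E = 0" using unbounded_shift_sums_0_1[OF X, of ?G] by auto
  then have "AE \<omega> in M. \<not> unbounded_shift_sums ?G (\<lambda>i. X i \<omega>)"
    by (subst (asm) prob_Collect_eq_0) auto
  then show ?thesis
  proof eventually_elim
    case (elim \<omega>)
    then obtain B :: nat where B: "shift_sum ?G n (\<lambda>i. X i \<omega>) \<le> real B" for n
      unfolding unbounded_shift_sums_def by (auto simp: not_less)
    obtain N :: nat where N: "real B / (c - e) \<le> N" using real_arch_simple by blast
    show ?case unfolding eventually_sequentially
    proof (intro exI allI impI)
      fix n assume "N \<le> n"
      then have "real B / (c - e) \<le> n" using N by linarith
      then have "real B \<le> (c - e) * n" using e by (simp add: field_simps)
      moreover have "(\<Sum>k<n. F (\<lambda>i. X (i + k) \<omega>)) - e * n \<le> real B"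
        using B[of n] unfolding shift_sum_def by (simp add: sum_subtractf mult.commute)
      ultimately show "(\<Sum>k<n. F (\<lambda>i. X (i + k) \<omega>)) \<le> c * real n" by (simp add: algebra_simps)
    qed
  qed
qed

section \<open>Extremes and runs in i.i.d. sequences\<close>

lemma (in prob_space) iid_prob_eq:
  assumes X: "iid X" and [measurable]: "B \<in> sets borel"
  shows "prob {\<omega> \<in> space M. X i \<omega> \<in> B} = prob {\<omega> \<in> space M. X j \<omega> \<in> B}"
proof -
  have "prob {\<omega> \<in> space M. X i \<omega> \<in> B} = measure (distr M borel (X i)) B" for i
    using iid_rv[OF X, of i] by (subst measure_distr) (auto simp: vimage_def Int_def conj_commute)
  moreover have "distr M borel (X i) = distr M borel (X j)" using X unfolding iid_def by blast
  ultimately show ?thesis by simp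
qed

lemma (in prob_space) iid_prob_Ball:
  assumes X: "iid X" and J: "finite J" and A: "\<And>j. j \<in> J \<Longrightarrow> A j \<in> sets borel"
  shows "prob {\<omega> \<in> space M. \<forall>j\<in>J. X j \<omega> \<in> A j} = (\<Prod>j\<in>J. prob {\<omega> \<in> space M. X i \<omega> \<in> A j})"
proof (cases "J = {}")
  case True
  then show ?thesis by (simp add: prob_space)
next
  case False
  have *: "X j -` A j \<inter> space M = {\<omega> \<in> space M. X j \<omega> \<in> A j}" for j by auto
  have "prob (\<Inter>j\<in>J. X j -` A j \<inter> space M) = (\<Prod>j\<in>J. prob (X j -` A j \<inter> space M))"
    using X J False A unfolding iid_def by (intro indep_varsD) auto
  moreover have "(\<Inter>j\<in>J. X j -` A j \<inter> space M) = {\<omega> \<in> space M. \<forall>j\<in>J. X j \<omega> \<in> A j}"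
    using False by auto
  moreover have "prob {\<omega> \<in> space M. X j \<omega> \<in> A j} = prob {\<omega> \<in> space M. X i \<omega> \<in> A j}" if "j \<in> J" for j
    by (rule iid_prob_eq[OF X A[OF that]])
  ultimately show ?thesis by (simp add: *)
qed

lemma (in prob_space) borel_cantelli_le:
  assumes A: "\<And>n. A n \<in> events" and le: "\<And>n. n \<ge> N \<Longrightarrow> prob (A n) \<le> q n" and q: "summable q"
  shows "AE \<omega> in M. \<forall>\<^sub>F n in sequentially. \<omega> \<notin> A n"
proof -
  have "summable (\<lambda>n. prob (A n))"
    by (rule summable_comparison_test'[OF q, of N]) (simp add: le)
  from borel_cantelli_AE1[OF A _ this] show ?thesis
    by (auto simp: less_top[symmetric] elim!: AE_mp intro!: AE_I2 elim: eventually_mono)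
qed

text \<open>Let \<open>A\<^sub>n\<close> be the event that the first \<open>n\<close> variables stay below \<open>b n\<close>. The sum of the \<open>P (A\<^sub>n)\<close> may
  diverge, so Borel-Cantelli does not apply to \<open>A\<^sub>n\<close> directly. However, leaving the event, that is
  \<open>A\<^sub>n\<close> without \<open>A\<^sub>n\<^sub>+\<^sub>1\<close>, forces variable number \<open>n\<close> to jump above \<open>b n\<close> since \<open>b\<close> increases, and this
  has probability at most \<open>\<psi> (b n) e\<^sup>-\<^sup>n\<^sup>\<psi>\<close>, which is summable. So eventually \<open>A\<^sub>n\<close> can no longer be left;
  being trapped in it forever has probability at most \<open>inf P (A\<^sub>n) = 0\<close>.\<close>

lemma (in prob_space) iid_max_exceeds:
  fixes X :: "nat \<Rightarrow> 'a \<Rightarrow> real" and b :: "nat \<Rightarrow> real"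
  assumes X: "iid X" and b: "incseq b"
    and \<psi>: "\<And>t. \<psi> t = prob {\<omega> \<in> space M. X 0 \<omega> > t}"
    and inf: "filterlim (\<lambda>n. real n * \<psi> (b n)) at_top sequentially"
    and sum: "summable (\<lambda>n. \<psi> (b n) * exp (- (real n * \<psi> (b n))))"
  shows "AE \<omega> in M. \<forall>\<^sub>F n in sequentially. \<exists>i<n. X i \<omega> > b n"
proof -
  note [measurable] = iid_rv[OF X]
  define A where "A = (\<lambda>n. {\<omega> \<in> space M. \<forall>i\<in>{..<n}. X i \<omega> \<in> {..b n}})"
  define B where "B = (\<lambda>n. {\<omega> \<in> space M. \<forall>i\<in>{..n}. X i \<omega> \<in> (if i < n then {..b n} else {b n<..})})"
  have [measurable]: "A n \<in> events" for n unfolding A_def by measurable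
  have [measurable]: "(if i < n then {..b n} else {b n<..}) \<in> sets borel" for i n by simp
  have [measurable]: "B n \<in> events" for n unfolding B_def by measurable
  have \<psi>': "prob {\<omega> \<in> space M. X 0 \<omega> \<in> {..t}} = 1 - \<psi> t" for t
  proof -
    have "{\<omega> \<in> space M. X 0 \<omega> \<in> {..t}} = space M - {\<omega> \<in> space M. X 0 \<omega> > t}" by auto
    then show ?thesis by (simp add: prob_compl \<psi>)
  qed
  have pow: "(1 - \<psi> t) ^ n \<le> exp (- (real n * \<psi> t))" for n t
  proof -
    have "(1 - \<psi> t) ^ n \<le> exp (- \<psi> t) ^ n"
      using exp_ge_add_one_self[of "- \<psi> t"] by (intro power_mono) (auto simp: \<psi>)
    then show ?thesis by (simp add: exp_of_nat_mult[symmetric])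
  qed
  have pA: "prob (A n) \<le> exp (- (real n * \<psi> (b n)))" for n
  proof -
    have "prob (A n) = (1 - \<psi> (b n)) ^ n"
      unfolding A_def by (subst iid_prob_Ball[OF X, of _ _ 0]) (auto simp del: atMost_iff simp: \<psi>')
    then show ?thesis using pow[of "b n" n] by simp
  qed
  have pB: "prob (B n) \<le> \<psi> (b n) * exp (- (real n * \<psi> (b n)))" for n
  proof -
    have "prob (B n) = (\<Prod>i\<in>{..n}. prob {\<omega> \<in> space M. X 0 \<omega> \<in> (if i < n then {..b n} else {b n<..})})"
      unfolding B_def by (subst iid_prob_Ball[OF X, of _ _ 0]) auto
    also have "{..n} = insert n {..<n}" by auto
    also have "(\<Prod>i\<in>insert n {..<n}. prob {\<omega> \<in> space M. X 0 \<omega> \<in> (if i < n then {..b n} else {b n<..})})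
      = \<psi> (b n) * (1 - \<psi> (b n)) ^ n"
      by (subst prod.insert) (auto simp: \<psi> simp del: atMost_iff simp: \<psi>'[unfolded \<psi>])
    finally show ?thesis using pow[of "b n" n] by (auto intro!: mult_left_mono simp: \<psi>)
  qed
  have "AE \<omega> in M. \<forall>\<^sub>F n in sequentially. \<omega> \<notin> B n"
    by (rule borel_cantelli_le[OF _ pB sum]) auto
  moreover have "AE \<omega> in M. \<not> (\<forall>n\<ge>m. \<omega> \<in> A n)" for m
  proof -
    have "(\<lambda>n. exp (- (real n * \<psi> (b n)))) \<longlonglongrightarrow> 0"
      using inf by (intro filterlim_compose[OF exp_at_bot] filterlim_compose[OF filterlim_uminus_at_bot_at_top])
    moreover have "\<forall>\<^sub>F n in sequentially. prob {\<omega> \<in> space M. \<forall>n\<ge>m. \<omega> \<in> A n} \<le> exp (- (real n * \<psi> (b n)))"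
      unfolding eventually_sequentially
    proof (intro exI[of _ m] allI impI)
      fix n assume "m \<le> n"
      then have "prob {\<omega> \<in> space M. \<forall>n\<ge>m. \<omega> \<in> A n} \<le> prob (A n)" by (intro finite_measure_mono) auto
      then show "prob {\<omega> \<in> space M. \<forall>n\<ge>m. \<omega> \<in> A n} \<le> exp (- (real n * \<psi> (b n)))" using pA[of n] by simp
    qed
    ultimately have "prob {\<omega> \<in> space M. \<forall>n\<ge>m. \<omega> \<in> A n} \<le> 0"
      by (intro tendsto_lowerbound[of _ 0 sequentially]) auto
    then have "prob {\<omega> \<in> space M. \<forall>n\<ge>m. \<omega> \<in> A n} = 0" by (simp add: measure_le_0_iff)
    then show ?thesis by (subst (asm) prob_Collect_eq_0) auto
  qed
  then have "AE \<omega> in M. \<forall>m. \<not> (\<forall>n\<ge>m. \<omega> \<in> A n)" by (simp add: AE_all_countable)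
  ultimately show ?thesis using AE_space
  proof eventually_elim
    case (elim \<omega>)
    then obtain N where N: "\<And>n. n \<ge> N \<Longrightarrow> \<omega> \<notin> B n" by (auto simp: eventually_sequentially)
    have step: "\<omega> \<in> A (Suc n)" if "n \<ge> N" "\<omega> \<in> A n" for n
    proof -
      have "b n \<le> b (Suc n)" using b by (simp add: incseq_SucD)
      moreover have "X n \<omega> \<le> b n"
        using N[OF that(1)] that(2) \<open>\<omega> \<in> space M\<close> unfolding A_def B_def
        by (auto simp: not_less split: if_splits) (metis le_neq_implies_less lessThan_iff)
      ultimately show ?thesis using that(2) unfolding A_def by (force simp: less_Suc_eq)
    qed
    have "\<omega> \<notin> A n" if "n \<ge> N" for n
    proof
      assume "\<omega> \<in> A n"
      then have "\<omega> \<in> A (n + k)" for k using step that by (induction k) auto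
      then have "\<forall>m\<ge>n. \<omega> \<in> A m" by (metis le_Suc_ex)
      with elim show False by blast
    qed
    then show ?case using \<open>\<omega> \<in> space M\<close> unfolding A_def eventually_sequentially
      by (intro exI[of _ N]) (auto simp: not_le)
  qed
qed

lemma (in prob_space) positive_exceeds_level:
  assumes [measurable]: "random_variable borel X" and pos: "AE \<omega> in M. X \<omega> > (0::real)"
  obtains \<delta> where "\<delta> > 0" "prob {\<omega> \<in> space M. X \<omega> \<le> \<delta>} < 1"
proof -
  have "\<exists>n::nat. prob {\<omega> \<in> space M. X \<omega> \<le> 1 / Suc n} \<noteq> 1"
  proof (rule ccontr)
    assume "\<not> ?thesis"
    then have "AE \<omega> in M. X \<omega> \<le> 1 / Suc n" for n by (subst prob_Collect_eq_1[symmetric]) auto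
    then have "AE \<omega> in M. \<forall>n. X \<omega> \<le> 1 / Suc n" by (simp add: AE_all_countable)
    with pos have "AE \<omega> in M. False"
    proof eventually_elim
      case (elim \<omega>)
      then show False by (metis nat_approx_posE not_less)
    qed
    then show False by simp
  qed
  then obtain n :: nat where "prob {\<omega> \<in> space M. X \<omega> \<le> 1 / Suc n} \<noteq> 1" by blast
  then have "prob {\<omega> \<in> space M. X \<omega> \<le> 1 / Suc n} < 1" using prob_le_1 order_le_less by blast
  then show ?thesis by (intro that[of "1 / Suc n"]) auto
qed

text \<open>A given window of length \<open>l\<close> contains only values below \<open>\<delta>\<close> with probability at most \<open>p ^ l\<close>. The
  factor \<open>4 / (- ln p)\<close> makes this \<open>L\<close> to the power \<open>-4\<close>, which beats the \<open>2 L\<^sup>2 + 1\<close> starting points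
  by a summable margin.\<close>

lemma (in prob_space) iid_log_windows:
  fixes Z :: "int \<Rightarrow> 'a \<Rightarrow> real"
  assumes Z: "iid Z" and p: "prob {\<omega> \<in> space M. Z 0 \<omega> \<le> \<delta>} \<le> p" "0 < p" "p < 1"
  shows "AE \<omega> in M. \<forall>\<^sub>F L :: nat in sequentially.
    \<forall>k\<in>{- int (L^2)..int (L^2)}. \<exists>i\<in>{k..<k + int (nat \<lceil>4 / (- ln p) * ln (real L)\<rceil>)}. Z i \<omega> > \<delta>"
proof -
  note [measurable] = iid_rv[OF Z]
  define l where "l = (\<lambda>L::nat. nat \<lceil>4 / (- ln p) * ln (real L)\<rceil>)"
  define A where "A = (\<lambda>k L. {\<omega> \<in> space M. \<forall>i\<in>{k..<k + int (l L)}. Z i \<omega> \<in> {..\<delta>}})"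
  have [measurable]: "A k L \<in> events" for k L unfolding A_def by measurable
  have lnp: "ln p < 0" using p by simp
  have pA: "prob (A k L) \<le> real L powr -4" if "L > 0" for k L
  proof -
    have "prob (A k L) = prob {\<omega> \<in> space M. Z 0 \<omega> \<le> \<delta>} ^ l L"
      unfolding A_def by (subst iid_prob_Ball[OF Z, of _ _ 0]) auto
    also have "\<dots> \<le> p ^ l L" using p by (intro power_mono) auto
    also have "\<dots> = exp (real (l L) * ln p)" using p by (simp add: exp_of_nat_mult)
    also have "\<dots> \<le> exp (4 / (- ln p) * ln (real L) * ln p)"
      unfolding exp_le_cancel_iff using lnp by (intro mult_right_mono_neg) (auto simp: l_def real_nat_ceiling_ge)
    also have "4 / (- ln p) * ln (real L) * ln p = -4 * ln (real L)" using lnp by simp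
    also have "exp \<dots> = real L powr -4" using that by (simp add: powr_def)
    finally show ?thesis .
  qed
  define B where "B = (\<lambda>L. \<Union>k\<in>{- int (L^2)..int (L^2)}. A k L)"
  have "AE \<omega> in M. \<forall>\<^sub>F L in sequentially. \<omega> \<notin> B L"
  proof (rule borel_cantelli_le[where N = 1])
    show "B L \<in> events" for L unfolding B_def by measurable
    show "prob (B L) \<le> 3 * (1 / real L ^ 2)" if "L \<ge> 1" for L
    proof -
      have "prob (B L) \<le> (\<Sum>k\<in>{- int (L^2)..int (L^2)}. prob (A k L))"
        unfolding B_def by (intro finite_measure_subadditive_finite) auto
      also have "\<dots> \<le> (\<Sum>k\<in>{- int (L^2)..int (L^2)}. real L powr -4)" using that pA by (intro sum_mono) auto
      also have "\<dots> = (2 * real L ^ 2 + 1) * real L powr -4"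
        by (simp add: nat_add_distrib nat_mult_distrib nat_power_eq)
      also have "\<dots> \<le> (3 * real L ^ 2) * real L powr -4"
        using that by (intro mult_right_mono) auto
      also have "real L powr -4 = 1 / real L ^ 4"
        using that by (simp add: powr_minus_divide)
      also have "(3 * real L ^ 2) * (1 / real L ^ 4) = 3 * (1 / real L ^ 2)"
        using that by (simp add: field_simps power_def numeral_eq_Suc)
      finally show ?thesis .
    qed
    show "summable (\<lambda>L. 3 * (1 / real L ^ 2))"
      using inverse_power_summable[of 2, where 'a = real] by (intro summable_mult) (simp add: inverse_eq_divide)
  qed
  then show ?thesis using AE_space
  proof eventually_elim
    case (elim \<omega>)
    from elim(1) show ?case
    proof eventually_elim
      case (elim L)
      then show ?case using \<open>\<omega> \<in> space M\<close> unfolding A_def B_def l_def by (force simp: not_le)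
    qed
  qed
qed

section \<open>Long jumps carry little energy\<close>

lemma summable_stretched_exp:
  fixes c a :: real
  assumes "c > 0" "a > 0"
  shows "summable (\<lambda>n::nat. real n ^ k * exp (- (c * real n powr a)))"
proof (rule summable_comparison_test_bigo)
  show "(\<lambda>n::nat. real n ^ k * exp (- (c * real n powr a))) \<in> O(\<lambda>n. inverse (real n ^ 2))"
    using assms by real_asymp
  show "summable (\<lambda>n. norm (inverse (real n ^ 2)))"
    using inverse_power_summable[of 2, where 'a = real] by simp
qed

lemma (in prob_space) summable_integrable_of_expectation_bound:
  fixes t :: "nat \<Rightarrow> 'a \<Rightarrow> real"
  assumes nonneg: "\<And>d \<omega>. 0 \<le> t d \<omega>" and int: "\<And>d. integrable M (t d)"
    and le: "\<And>d. expectation (t d) \<le> q d" and q: "summable q"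
  shows "AE \<omega> in M. summable (\<lambda>d. t d \<omega>)" "integrable M (\<lambda>\<omega>. \<Sum>d. t d \<omega>)"
proof -
  note [measurable] = borel_measurable_integrable[OF int]
  have sE: "summable (\<lambda>d. expectation (t d))"
    by (rule summable_comparison_test'[OF q, of 0]) (simp add: le nonneg)
  have "(\<integral>\<^sup>+\<omega>. (\<Sum>d. ennreal (t d \<omega>)) \<partial>M) = (\<Sum>d. \<integral>\<^sup>+\<omega>. ennreal (t d \<omega>) \<partial>M)"
    by (rule nn_integral_suminf) auto
  also have "\<dots> = (\<Sum>d. ennreal (expectation (t d)))"
    using int nonneg by (subst nn_integral_eq_integral) auto
  also have "\<dots> = ennreal (\<Sum>d. expectation (t d))"
    using sE nonneg by (intro suminf_ennreal2) auto
  finally have "(\<integral>\<^sup>+\<omega>. (\<Sum>d. ennreal (t d \<omega>)) \<partial>M) \<noteq> \<infinity>" by simp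
  then have "AE \<omega> in M. (\<Sum>d. ennreal (t d \<omega>)) \<noteq> \<infinity>" by (intro nn_integral_PInf_AE) auto
  then show s: "AE \<omega> in M. summable (\<lambda>d. t d \<omega>)"
    by eventually_elim (rule summable_suminf_not_top, auto simp: nonneg)
  show "integrable M (\<lambda>\<omega>. \<Sum>d. t d \<omega>)"
    using s sE nonneg int by (intro integrable_suminf) auto
qed

text \<open>The contribution to the Dirichlet energy of the test function \<open>x\<^sub>k \<mapsto> k\<close> made by the jump of
  \<open>d + 1\<close> steps to the right that starts at the first point.\<close>

definition jump_energy :: "real \<Rightarrow> (nat \<Rightarrow> real) \<Rightarrow> nat \<Rightarrow> real" where
  "jump_energy \<alpha> z d = (real (Suc d))\<^sup>2 * exp (- ((\<Sum>i<Suc d. z i) powr \<alpha>))"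

lemma jump_energy_nonneg: "0 \<le> jump_energy \<alpha> z d"
  by (simp add: jump_energy_def)

lemma jump_energy_measurable [measurable]:
  "(\<lambda>z. jump_energy \<alpha> z d) \<in> borel_measurable (\<Pi>\<^sub>M i\<in>UNIV. borel)"
proof -
  have [measurable]: "(\<lambda>z :: nat \<Rightarrow> real. z i) \<in> borel_measurable (\<Pi>\<^sub>M i\<in>UNIV. borel)" for i
    by (rule measurable_component_singleton) simp
  show ?thesis unfolding jump_energy_def by measurable
qed

text \<open>This trades the stretched exponential, whose expectation at a sum of independent variables does
  not factor, for an ordinary exponential, at the price of a deterministic term. It is a Chernoff
  bound in pointwise form.\<close>

lemma stretched_exp_le:
  fixes r s \<alpha> :: real
  assumes "0 \<le> r" "0 \<le> s" "\<alpha> > 0"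
  shows "exp (- (r powr \<alpha>)) \<le> exp (s - r) + exp (- (s powr \<alpha>))"
proof (cases "r \<le> s")
  case True
  have "exp (- (r powr \<alpha>)) \<le> 1" by simp
  also have "1 \<le> exp (s - r)" using True by simp
  finally show ?thesis by (simp add: add_increasing2)
next
  case False
  then have "exp (- (r powr \<alpha>)) \<le> exp (- (s powr \<alpha>))" using assms by (simp add: powr_mono2)
  then show ?thesis by (simp add: add_increasing)
qed

text \<open>With \<open>\<phi> = E e\<^sup>-\<^sup>X < 1\<close>, the pointwise bound at the level \<open>s = c n\<close> gives an expected energy of at most
  \<open>n\<^sup>2 ((e\<^sup>c \<phi>)\<^sup>n + exp (- (c n)\<^sup>\<alpha>))\<close> for jumps of \<open>n\<close> steps, which is summable as soon as \<open>c > 0\<close> is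
  so small that \<open>e\<^sup>c \<phi> < 1\<close>.\<close>

lemma (in prob_space) jump_energy_summable_integrable:
  fixes X :: "nat \<Rightarrow> 'a \<Rightarrow> real"
  assumes X: "iid X" and pos: "\<And>i. AE \<omega> in M. X i \<omega> > 0" and \<alpha>: "\<alpha> > 0"
  shows "AE \<omega> in M. summable (jump_energy \<alpha> (\<lambda>i. X i \<omega>))"
    and "integrable M (\<lambda>\<omega>. \<Sum>d. jump_energy \<alpha> (\<lambda>i. X i \<omega>) d)"
proof -
  note [measurable] = iid_rv[OF X] iid_seq_measurable[OF X, of "\<lambda>i. i"]
  define \<phi> where "\<phi> = expectation (\<lambda>\<omega>. exp (- \<bar>X 0 \<omega>\<bar>))"
  have iexp: "integrable M (\<lambda>\<omega>. exp (- \<bar>X i \<omega>\<bar>))" for i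
    by (rule integrable_const_bound[where B = 1]) auto
  have \<phi>_eq: "expectation (\<lambda>\<omega>. exp (- \<bar>X i \<omega>\<bar>)) = \<phi>" for i
  proof -
    have "expectation (\<lambda>\<omega>. exp (- \<bar>X i \<omega>\<bar>)) = (\<integral>x. exp (- \<bar>x\<bar>) \<partial>distr M borel (X i))" for i
      by (subst integral_distr) auto
    moreover have "distr M borel (X i) = distr M borel (X 0)" using X unfolding iid_def by blast
    ultimately show ?thesis unfolding \<phi>_def by simp
  qed
  have "\<phi> < expectation (\<lambda>\<omega>. 1)" unfolding \<phi>_def
  proof (rule integral_less_AE_space)
    show "AE \<omega> in M. exp (- \<bar>X 0 \<omega>\<bar>) < 1" using pos[of 0] by eventually_elim simp
  qed (use iexp in \<open>auto simp: emeasure_space_1\<close>)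
  then have \<phi>1: "\<phi> < 1" by (simp add: prob_space)
  have \<phi>0: "0 \<le> \<phi>" unfolding \<phi>_def by simp
  \<comment> \<open>A substitute for \<open>\<phi>\<close> that is certainly positive, so that its logarithm can be used; \<open>c\<close> is chosen with \<open>e\<^sup>c \<phi>' = e\<^sup>-\<^sup>c\<close>.\<close>
  define \<phi>' where "\<phi>' = max \<phi> (1/2)"
  have \<phi>': "\<phi> \<le> \<phi>'" "0 < \<phi>'" "\<phi>' < 1" using \<phi>1 by (auto simp: \<phi>'_def)
  define c where "c = - ln \<phi>' / 2"
  define \<rho> where "\<rho> = exp c * \<phi>'"
  have c: "c > 0" using \<phi>' by (simp add: c_def)
  have "ln \<phi>' = - (2 * c)" unfolding c_def by simp
  then have "\<phi>' = exp (- (2 * c))" using \<phi>'(2) by (metis exp_ln)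
  then have "\<rho> = exp c * exp (- (2 * c))" unfolding \<rho>_def by (rule arg_cong)
  also have "\<dots> = exp (- c)" by (simp add: mult_exp_exp)
  finally have \<rho>': "\<rho> = exp (- c)" .
  have prods: "expectation (\<lambda>\<omega>. \<Prod>i<n. exp (- \<bar>X i \<omega>\<bar>)) = \<phi> ^ n"
    "integrable M (\<lambda>\<omega>. \<Prod>i<n. exp (- \<bar>X i \<omega>\<bar>))" for n
  proof -
    have iv: "indep_vars (\<lambda>_. borel) (\<lambda>i \<omega>. exp (- \<bar>X i \<omega>\<bar>)) {..<n}"
    proof (rule indep_vars_compose2[where Y = "\<lambda>_ x. exp (- \<bar>x\<bar>)" and N = "\<lambda>_. borel"])
      show "indep_vars (\<lambda>_. borel) X {..<n}"
        using X indep_vars_subset[of "\<lambda>_. borel" X UNIV "{..<n}"] unfolding iid_def by simp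
    qed measurable
    show "expectation (\<lambda>\<omega>. \<Prod>i<n. exp (- \<bar>X i \<omega>\<bar>)) = \<phi> ^ n"
      using iexp by (subst indep_vars_lebesgue_integral[OF _ iv]) (auto simp: \<phi>_eq)
    show "integrable M (\<lambda>\<omega>. \<Prod>i<n. exp (- \<bar>X i \<omega>\<bar>))"
      using iexp by (intro indep_vars_integrable[OF _ iv]) auto
  qed
  \<comment> \<open>Absolute values make the bounds hold everywhere rather than almost everywhere.\<close>
  define t where "t = (\<lambda>d \<omega>. jump_energy \<alpha> (\<lambda>i. \<bar>X i \<omega>\<bar>) d)"
  have nn: "0 \<le> t d \<omega>" for d \<omega> by (simp add: t_def jump_energy_def)
  have tm [measurable]: "t d \<in> borel_measurable M" for d
    unfolding t_def jump_energy_def by measurable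
  have tint: "integrable M (t d)" for d
    by (rule integrable_const_bound[where B = "(real (Suc d))\<^sup>2"]) (auto simp: t_def jump_energy_def)
  define q where "q = (\<lambda>n::nat. real n ^ 2 * exp (- (c * real n powr 1)) + real n ^ 2 * exp (- ((c powr \<alpha>) * real n powr \<alpha>)))"
  have q: "summable q" unfolding q_def using c \<alpha> by (intro summable_add summable_stretched_exp) auto
  have le: "expectation (t d) \<le> q (Suc d)" for d
  proof -
    let ?n = "Suc d"
    have "expectation (t d) \<le> expectation (\<lambda>\<omega>. (real ?n)\<^sup>2 * (exp (c * ?n) * (\<Prod>i<?n. exp (- \<bar>X i \<omega>\<bar>)) + exp (- ((c * ?n) powr \<alpha>))))"
    proof (rule integral_mono[OF tint])
      show "integrable M (\<lambda>\<omega>. (real ?n)\<^sup>2 * (exp (c * ?n) * (\<Prod>i<?n. exp (- \<bar>X i \<omega>\<bar>)) + exp (- ((c * ?n) powr \<alpha>))))"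
        by (auto simp del: of_nat_Suc prod.lessThan_Suc
            intro!: integrable_mult_right integrable_add prods(2))
      fix \<omega>
      have "exp (- ((\<Sum>i<?n. \<bar>X i \<omega>\<bar>) powr \<alpha>)) \<le> exp (c * ?n - (\<Sum>i<?n. \<bar>X i \<omega>\<bar>)) + exp (- ((c * ?n) powr \<alpha>))"
        using c \<alpha> by (intro stretched_exp_le sum_nonneg) auto
      also have "exp (c * ?n - (\<Sum>i<?n. \<bar>X i \<omega>\<bar>)) = exp (c * ?n) * (\<Prod>i<?n. exp (- \<bar>X i \<omega>\<bar>))"
        by (subst exp_sum[symmetric]) (simp_all only: finite_lessThan sum_negf exp_add[symmetric] diff_conv_add_uminus)
      finally show "t d \<omega> \<le> (real ?n)\<^sup>2 * (exp (c * ?n) * (\<Prod>i<?n. exp (- \<bar>X i \<omega>\<bar>)) + exp (- ((c * ?n) powr \<alpha>)))"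
        unfolding t_def jump_energy_def by (intro mult_left_mono) auto
    qed
    also have "\<dots> = (real ?n)\<^sup>2 * (exp (c * ?n) * \<phi> ^ ?n + exp (- ((c * ?n) powr \<alpha>)))"
      using prods by (simp del: of_nat_Suc prod.lessThan_Suc add: prob_space)
    also have "\<dots> \<le> (real ?n)\<^sup>2 * (exp (c * ?n) * \<phi>' ^ ?n + exp (- ((c * ?n) powr \<alpha>)))"
      using \<phi>' \<phi>0 by (intro mult_left_mono add_right_mono power_mono) auto
    also have "exp (c * ?n) * \<phi>' ^ ?n = \<rho> ^ ?n"
      unfolding \<rho>_def power_mult_distrib by (simp only: exp_of_nat_mult mult.commute[of c])
    also have "\<rho> ^ ?n = exp (- (c * real ?n powr 1))"
      unfolding \<rho>' by (simp only: exp_of_nat_mult[symmetric]) simp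
    also have "(c * ?n) powr \<alpha> = (c powr \<alpha>) * real ?n powr \<alpha>" using c by (simp add: powr_mult)
    finally show ?thesis unfolding q_def by (simp only: distrib_left)
  qed
  have q': "summable (\<lambda>d. q (Suc d))" using q by (subst summable_Suc_iff)
  have eq: "AE \<omega> in M. \<forall>d. jump_energy \<alpha> (\<lambda>i. X i \<omega>) d = t d \<omega>"
  proof -
    have "AE \<omega> in M. \<forall>i. X i \<omega> > 0" using pos by (simp add: AE_all_countable)
    then show ?thesis by eventually_elim (simp add: t_def abs_of_pos)
  qed
  show "AE \<omega> in M. summable (jump_energy \<alpha> (\<lambda>i. X i \<omega>))"
    using summable_integrable_of_expectation_bound(1)[OF nn tint le q'] eq
  proof eventually_elim
    case (elim \<omega>)
    then have "jump_energy \<alpha> (\<lambda>i. X i \<omega>) = (\<lambda>d. t d \<omega>)" by auto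
    with elim show ?case by simp
  qed
  have "integrable M (\<lambda>\<omega>. \<Sum>d. jump_energy \<alpha> (\<lambda>i. X i \<omega>) d) \<longleftrightarrow> integrable M (\<lambda>\<omega>. \<Sum>d. t d \<omega>)"
  proof (rule integrable_cong_AE)
    have "(\<lambda>z. \<Sum>d. jump_energy \<alpha> z d) \<in> borel_measurable (\<Pi>\<^sub>M i\<in>UNIV. borel)"
      by (intro borel_measurable_suminf jump_energy_measurable)
    from measurable_compose[OF iid_seq_measurable[OF X, of "\<lambda>i. i"] this]
    show "(\<lambda>\<omega>. \<Sum>d. jump_energy \<alpha> (\<lambda>i. X i \<omega>) d) \<in> borel_measurable M" .
    show "AE \<omega> in M. (\<Sum>d. jump_energy \<alpha> (\<lambda>i. X i \<omega>) d) = (\<Sum>d. t d \<omega>)"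
      using eq by eventually_elim simp
  qed measurable
  with summable_integrable_of_expectation_bound(2)[OF nn tint le q']
  show "integrable M (\<lambda>\<omega>. \<Sum>d. jump_energy \<alpha> (\<lambda>i. X i \<omega>) d)" by simp
qed

text \<open>The energy of all jumps within \<open>n\<close> points is at most the sum over the starting points of one
  integrable functional of the shifted sequence, whatever clusters the points may form.\<close>

lemma (in prob_space) jump_energy_linear:
  fixes X :: "nat \<Rightarrow> 'a \<Rightarrow> real"
  assumes X: "iid X" and pos: "\<And>i. AE \<omega> in M. X i \<omega> > 0" and \<alpha>: "\<alpha> > 0"
  obtains C where "C > 0"
    "AE \<omega> in M. \<forall>\<^sub>F n in sequentially. (\<Sum>k<n. \<Sum>d<n. jump_energy \<alpha> (\<lambda>i. X (i + k) \<omega>) d) \<le> C * real n"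
proof -
  define F where "F = (\<lambda>z. \<Sum>d. jump_energy \<alpha> z d)"
  have F: "F \<in> borel_measurable (\<Pi>\<^sub>M i\<in>UNIV. borel)"
    unfolding F_def by (intro borel_measurable_suminf jump_energy_measurable)
  define C where "C = max 1 (expectation (\<lambda>\<omega>. F (\<lambda>i. X i \<omega>)) + 1)"
  have "AE \<omega> in M. \<forall>\<^sub>F n in sequentially. (\<Sum>k<n. F (\<lambda>i. X (i + k) \<omega>)) \<le> C * real n"
    using jump_energy_summable_integrable(2)[OF X pos \<alpha>]
    by (intro iid_ergodic_upper[OF X F]) (auto simp: F_def C_def)
  moreover have "AE \<omega> in M. summable (jump_energy \<alpha> (\<lambda>i. X (i + k) \<omega>))" for k
    using pos by (intro jump_energy_summable_integrable(1) iid_reindex[OF X] \<alpha>) (auto simp: inj_def)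
  then have "AE \<omega> in M. \<forall>k. summable (jump_energy \<alpha> (\<lambda>i. X (i + k) \<omega>))" by (simp add: AE_all_countable)
  ultimately have "AE \<omega> in M. \<forall>\<^sub>F n in sequentially. (\<Sum>k<n. \<Sum>d<n. jump_energy \<alpha> (\<lambda>i. X (i + k) \<omega>) d) \<le> C * real n"
  proof eventually_elim
    case (elim \<omega>)
    note s = elim(2)
    from elim(1) show ?case
    proof eventually_elim
      case (elim n)
      have "(\<Sum>k<n. \<Sum>d<n. jump_energy \<alpha> (\<lambda>i. X (i + k) \<omega>) d) \<le> (\<Sum>k<n. F (\<lambda>i. X (i + k) \<omega>))"
        unfolding F_def using s by (intro sum_mono sum_le_suminf) (auto simp: jump_energy_nonneg)
      with elim show ?case by simp
    qed
  qed
  then show ?thesis by (intro that[of C]) (auto simp: C_def)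
qed

section \<open>Variational bounds for the spectral gap\<close>

definition total_variance :: "real set \<Rightarrow> (real \<Rightarrow> real) \<Rightarrow> real" where
  "total_variance X f = (\<Sum>x\<in>X. \<Sum>y\<in>X. (f x - f y)\<^sup>2)"

definition dirichlet_energy :: "real \<Rightarrow> real set \<Rightarrow> (real \<Rightarrow> real) \<Rightarrow> real" where
  "dirichlet_energy \<alpha> X f = (\<Sum>x\<in>X. \<Sum>y\<in>X. exp (- (\<bar>x - y\<bar> powr \<alpha>)) * (f x - f y)\<^sup>2)"

lemma poincare_const_eq:
  "poincare_const \<alpha> \<xi> L = (SUP f\<in>{f :: real \<Rightarrow> real. \<not> f constant_on box_points \<xi> L}.
     1 / real (card (box_points \<xi> L)) * (total_variance (box_points \<xi> L) f / dirichlet_energy \<alpha> (box_points \<xi> L) f))"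
  unfolding poincare_const_def total_variance_def dirichlet_energy_def Let_def ..

lemma total_variance_pos_iff:
  fixes f :: "real \<Rightarrow> real"
  assumes "finite X"
  shows "0 < total_variance X f \<longleftrightarrow> \<not> f constant_on X"
proof
  assume "0 < total_variance X f"
  then show "\<not> f constant_on X" unfolding total_variance_def constant_on_def by force
next
  assume "\<not> f constant_on X"
  then have "X \<noteq> {}" unfolding constant_on_def by blast
  then obtain a where "a \<in> X" by blast
  then obtain b where b: "b \<in> X" "f a \<noteq> f b" using \<open>\<not> f constant_on X\<close> unfolding constant_on_def by metis
  have "0 < (f a - f b)\<^sup>2" using b by simp
  also have "\<dots> \<le> (\<Sum>y\<in>X. (f a - f y)\<^sup>2)" using assms b by (intro member_le_sum) auto
  also have "\<dots> \<le> total_variance X f" unfolding total_variance_def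
    using assms \<open>a \<in> X\<close> by (intro member_le_sum sum_nonneg) auto
  finally show "0 < total_variance X f" .
qed

text \<open>All rates inside the box are at least \<open>exp (- L\<^sup>\<alpha>)\<close>. This crude bound makes the supremum that defines
  the Poincare constant finite, so that single test functions bound it from below.\<close>

lemma total_variance_le_dirichlet_energy:
  assumes "X \<subseteq> {- L / 2..L / 2}" "\<alpha> > 0"
  shows "total_variance X f \<le> exp (L powr \<alpha>) * dirichlet_energy \<alpha> X f"
  unfolding total_variance_def dirichlet_energy_def sum_distrib_left
proof (intro sum_mono)
  fix x y assume "x \<in> X" "y \<in> X"
  then have "x \<in> {- L / 2..L / 2}" "y \<in> {- L / 2..L / 2}" using assms by auto
  then have "\<bar>x - y\<bar> powr \<alpha> \<le> L powr \<alpha>" using assms by (intro powr_mono2) (auto simp: abs_le_iff)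
  then have "1 \<le> exp (L powr \<alpha>) * exp (- (\<bar>x - y\<bar> powr \<alpha>))" by (simp flip: exp_add)
  then have "1 * (f x - f y)\<^sup>2 \<le> (exp (L powr \<alpha>) * exp (- (\<bar>x - y\<bar> powr \<alpha>))) * (f x - f y)\<^sup>2"
    by (rule mult_right_mono) simp
  then show "(f x - f y)\<^sup>2 \<le> exp (L powr \<alpha>) * (exp (- (\<bar>x - y\<bar> powr \<alpha>)) * (f x - f y)\<^sup>2)" by (simp add: mult.assoc)
qed

lemma box_points_subset: "box_points \<xi> L \<subseteq> {- L / 2..L / 2}"
  by (simp add: box_points_def)

lemma dirichlet_energy_pos:
  fixes f :: "real \<Rightarrow> real"
  assumes "finite (box_points \<xi> L)" "\<alpha> > 0" "\<not> f constant_on box_points \<xi> L"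
  shows "0 < dirichlet_energy \<alpha> (box_points \<xi> L) f"
proof -
  have "0 < exp (L powr \<alpha>) * dirichlet_energy \<alpha> (box_points \<xi> L) f"
    using total_variance_le_dirichlet_energy[OF box_points_subset assms(2)] assms total_variance_pos_iff
    by (meson less_le_trans)
  then show ?thesis by (simp add: zero_less_mult_iff)
qed

lemma poincare_quotient_le:
  fixes f :: "real \<Rightarrow> real"
  assumes fin: "finite (box_points \<xi> L)" and \<alpha>: "\<alpha> > 0" and f: "\<not> f constant_on box_points \<xi> L"
  shows "1 / real (card (box_points \<xi> L)) * (total_variance (box_points \<xi> L) f / dirichlet_energy \<alpha> (box_points \<xi> L) f)
    \<le> poincare_const \<alpha> \<xi> L"
  unfolding poincare_const_eq
proof (rule cSUP_upper)
  show "bdd_above ((\<lambda>f. 1 / real (card (box_points \<xi> L)) * (total_variance (box_points \<xi> L) f / dirichlet_energy \<alpha> (box_points \<xi> L) f)) `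
     {f :: real \<Rightarrow> real. \<not> f constant_on box_points \<xi> L})"
  proof (rule bdd_aboveI2)
    fix f :: "real \<Rightarrow> real" assume "f \<in> {f :: real \<Rightarrow> real. \<not> f constant_on box_points \<xi> L}"
    then have "0 < dirichlet_energy \<alpha> (box_points \<xi> L) f" using dirichlet_energy_pos[OF fin \<alpha>] by simp
    then have "total_variance (box_points \<xi> L) f / dirichlet_energy \<alpha> (box_points \<xi> L) f \<le> exp (L powr \<alpha>)"
      using total_variance_le_dirichlet_energy[OF box_points_subset \<alpha>] by (simp add: divide_le_eq)
    then show "1 / real (card (box_points \<xi> L)) * (total_variance (box_points \<xi> L) f / dirichlet_energy \<alpha> (box_points \<xi> L) f)
      \<le> 1 / real (card (box_points \<xi> L)) * exp (L powr \<alpha>)" by (intro mult_left_mono) auto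
  qed
qed (use f in simp)

lemma spectral_gap_le_test_function:
  assumes fin: "finite (box_points \<xi> L)" and \<alpha>: "\<alpha> > 0"
    and v: "0 < v" "v \<le> total_variance (box_points \<xi> L) f"
    and e: "dirichlet_energy \<alpha> (box_points \<xi> L) f \<le> e"
  shows "spectral_gap \<alpha> \<xi> L \<le> real (card (box_points \<xi> L)) * e / v"
proof -
  let ?X = "box_points \<xi> L"
  have f: "\<not> f constant_on ?X" using v fin total_variance_pos_iff by (metis less_le_trans)
  have "?X \<noteq> {}" using f unfolding constant_on_def by blast
  then have c: "0 < card ?X" using fin by (simp add: card_gt_0_iff)
  have E: "0 < dirichlet_energy \<alpha> ?X f" by (rule dirichlet_energy_pos[OF fin \<alpha> f])
  have "1 / card ?X * (v / e) \<le> 1 / card ?X * (total_variance ?X f / dirichlet_energy \<alpha> ?X f)"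
    using v e E by (intro mult_left_mono frac_le) auto
  also have "\<dots> \<le> poincare_const \<alpha> \<xi> L" by (rule poincare_quotient_le[OF fin \<alpha> f])
  finally have "inverse (poincare_const \<alpha> \<xi> L) \<le> inverse (1 / card ?X * (v / e))"
    using c v e E by (intro le_imp_inverse_le) auto
  then show ?thesis unfolding spectral_gap_def by (simp add: field_simps)
qed

lemma spectral_gap_ge:
  fixes B :: real
  assumes fin: "finite (box_points \<xi> L)" and \<alpha>: "\<alpha> > 0" and ab: "a \<in> box_points \<xi> L" "b \<in> box_points \<xi> L" "a \<noteq> b"
    and B: "\<And>f. total_variance (box_points \<xi> L) f \<le> B * real (card (box_points \<xi> L)) * dirichlet_energy \<alpha> (box_points \<xi> L) f"
  shows "1 / B \<le> spectral_gap \<alpha> \<xi> L"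
proof -
  let ?X = "box_points \<xi> L"
  have id: "\<not> (\<lambda>x::real. x) constant_on ?X" using ab unfolding constant_on_def by metis
  have c: "0 < card ?X" using fin ab by (auto simp: card_gt_0_iff)
  have "poincare_const \<alpha> \<xi> L \<le> B"
    unfolding poincare_const_eq
  proof (rule cSUP_least)
    fix f :: "real \<Rightarrow> real" assume "f \<in> {f :: real \<Rightarrow> real. \<not> f constant_on ?X}"
    then have "0 < dirichlet_energy \<alpha> ?X f" using dirichlet_energy_pos[OF fin \<alpha>] by simp
    then show "1 / real (card ?X) * (total_variance ?X f / dirichlet_energy \<alpha> ?X f) \<le> B"
      using B[of f] c by (simp add: field_simps)
  qed (use id in auto)
  moreover have "0 < poincare_const \<alpha> \<xi> L"
  proof -
    have "0 < 1 / real (card ?X) * (total_variance ?X (\<lambda>x. x) / dirichlet_energy \<alpha> ?X (\<lambda>x. x))"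
      using c total_variance_pos_iff[OF fin] dirichlet_energy_pos[OF fin \<alpha> id] id by simp
    then show ?thesis using poincare_quotient_le[OF fin \<alpha> id] by linarith
  qed
  ultimately show ?thesis unfolding spectral_gap_def
    by (simp add: inverse_eq_divide frac_le)
qed

section \<open>Renewal points as an indexed chain\<close>

lemma renewal_point_Suc: "renewal_point z (k + 1) = renewal_point z k + z k"
  using renewal_point_rec[of z "k + 1"] by simp

lemma renewal_point_diff:
  assumes "i \<le> j"
  shows "renewal_point z j - renewal_point z i = (\<Sum>k\<in>{i..<j}. z k)"
  using assms
proof (induction j rule: int_ge_induct)
  case (step j)
  have "{i..<j + 1} = insert j {i..<j}" using step by auto
  then show ?case using step by (simp add: renewal_point_Suc)
qed simp

lemma renewal_point_strict_mono:
  assumes "\<And>i. z i > 0"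
  shows "strict_mono (renewal_point z)"
proof (rule strict_monoI)
  fix i j :: int assume "i < j"
  then have "0 < (\<Sum>k\<in>{i..<j}. z k)" using assms by (intro sum_pos) auto
  then show "renewal_point z i < renewal_point z j" using renewal_point_diff[of i j z] \<open>i < j\<close> by simp
qed

lemma renewal_point_right: "renewal_point z (int n) = (\<Sum>i<n. z (int i))"
proof (induction n)
  case (Suc n)
  then show ?case using renewal_point_Suc[of z "int n"] by (simp add: add.commute)
qed (simp add: renewal_point_0)

text \<open>Reflection turns every statement about the points to the right of the origin into one about the
  points to its left.\<close>

lemma renewal_point_reflect: "renewal_point (\<lambda>i. z (- 1 - i)) k = - renewal_point z (- k)"
proof -
  have *: "renewal_point (\<lambda>i. z (- 1 - i)) (int n) = - renewal_point z (- int n)" for z n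
  proof (induction n)
    case (Suc n)
    have "renewal_point z (- int n) = renewal_point z (- int n - 1) + z (- int n - 1)"
      using renewal_point_rec[of z "- int n"] by simp
    moreover have "- int (Suc n) = - int n - 1" by simp
    moreover have "renewal_point (\<lambda>i. z (- 1 - i)) (int (Suc n)) = renewal_point (\<lambda>i. z (- 1 - i)) (int n) + z (- 1 - int n)"
      using renewal_point_Suc[of "\<lambda>i. z (- 1 - i)" "int n"] by (simp add: add.commute)
    moreover have "- 1 - int n = - int n - 1" by simp
    ultimately show ?case using Suc by (simp only:)
  qed (simp add: renewal_point_0)
  show ?thesis
  proof (cases "0 \<le> k")
    case True
    then show ?thesis using *[of z "nat k"] by simp
  next
    case False
    then show ?thesis using *[of "\<lambda>i. z (- 1 - i)" "nat (- k)"] by simp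
  qed
qed

definition box_index :: "(int \<Rightarrow> real) \<Rightarrow> real \<Rightarrow> int set" where
  "box_index z L = {k. renewal_point z k \<in> {- L / 2..L / 2}}"

lemma box_points_renewal_set: "box_points (renewal_set z) L = renewal_point z ` box_index z L"
  unfolding box_points_def renewal_set_def box_index_def by auto

lemma card_box_points:
  assumes "\<And>i. z i > 0"
  shows "card (box_points (renewal_set z) L) = card (box_index z L)"
  unfolding box_points_renewal_set
  using renewal_point_strict_mono[OF assms] by (intro card_image) (auto simp: strict_mono_eq inj_on_def)

lemma total_variance_box:
  assumes "\<And>i. z i > 0"
  shows "total_variance (box_points (renewal_set z) L) f =
    (\<Sum>i\<in>box_index z L. \<Sum>j\<in>box_index z L. (f (renewal_point z i) - f (renewal_point z j))\<^sup>2)"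
proof -
  have "inj_on (renewal_point z) I" for I
    using renewal_point_strict_mono[OF assms] by (auto simp: strict_mono_eq inj_on_def)
  then show ?thesis unfolding total_variance_def box_points_renewal_set by (simp add: sum.reindex)
qed

lemma dirichlet_energy_box:
  assumes "\<And>i. z i > 0"
  shows "dirichlet_energy \<alpha> (box_points (renewal_set z) L) f =
    (\<Sum>i\<in>box_index z L. \<Sum>j\<in>box_index z L.
       exp (- (\<bar>renewal_point z i - renewal_point z j\<bar> powr \<alpha>)) * (f (renewal_point z i) - f (renewal_point z j))\<^sup>2)"
proof -
  have "inj_on (renewal_point z) I" for I
    using renewal_point_strict_mono[OF assms] by (auto simp: strict_mono_eq inj_on_def)
  then show ?thesis unfolding dirichlet_energy_def box_points_renewal_set by (simp add: sum.reindex)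
qed

lemma spectral_gap_le_index_test_function:
  assumes z: "\<And>i. z i > 0" and fin: "finite (box_index z L)" and \<alpha>: "\<alpha> > 0"
    and v: "0 < v" "v \<le> (\<Sum>i\<in>box_index z L. \<Sum>j\<in>box_index z L. (h i - h j :: real)\<^sup>2)"
    and e: "(\<Sum>i\<in>box_index z L. \<Sum>j\<in>box_index z L.
       exp (- (\<bar>renewal_point z i - renewal_point z j\<bar> powr \<alpha>)) * (h i - h j)\<^sup>2) \<le> e"
  shows "spectral_gap \<alpha> (renewal_set z) L \<le> real (card (box_index z L)) * e / v"
proof -
  define f where "f = h \<circ> inv (renewal_point z)"
  have "inj (renewal_point z)"
    using renewal_point_strict_mono[OF z] by (auto simp: strict_mono_eq inj_on_def)
  then have f: "f (renewal_point z i) = h i" for i by (simp add: f_def)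
  have "spectral_gap \<alpha> (renewal_set z) L \<le> real (card (box_points (renewal_set z) L)) * e / v"
    using fin \<alpha> v e
    by (intro spectral_gap_le_test_function[where f = f])
      (auto simp: box_points_renewal_set total_variance_box[OF z, unfolded box_points_renewal_set]
        dirichlet_energy_box[OF z, unfolded box_points_renewal_set] f)
  then show ?thesis by (simp add: card_box_points[OF z])
qed

text \<open>Cauchy-Schwarz along the nearest-neighbour path, with the resistances \<open>exp w\<close> as weights.\<close>

lemma path_inequality:
  fixes g w :: "int \<Rightarrow> real"
  assumes "i \<le> j"
  shows "(g j - g i)\<^sup>2 \<le> (\<Sum>k\<in>{i..<j}. exp (w k)) * (\<Sum>k\<in>{i..<j}. exp (- w k) * (g (k + 1) - g k)\<^sup>2)"
proof -
  have "g j - g i = (\<Sum>k\<in>{i..<j}. g (k + 1) - g k)"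
    using \<open>i \<le> j\<close>
  proof (induction j rule: int_ge_induct)
    case (step j)
    have "{i..<j + 1} = insert j {i..<j}" using step by auto
    then show ?case using step by simp
  qed simp
  also have "\<dots> = (\<Sum>k\<in>{i..<j}. exp (w k / 2) * (exp (- w k / 2) * (g (k + 1) - g k)))"
    by (simp add: mult.assoc[symmetric] exp_add[symmetric])
  finally have "(g j - g i)\<^sup>2 \<le> (\<Sum>k\<in>{i..<j}. (exp (w k / 2))\<^sup>2) * (\<Sum>k\<in>{i..<j}. (exp (- w k / 2) * (g (k + 1) - g k))\<^sup>2)"
    using Cauchy_Schwarz_ineq_sum by simp
  then show ?thesis by (simp add: power_mult_distrib exp_double[symmetric])
qed

text \<open>Keeping only nearest-neighbour jumps, every pair of points in the box is joined by a path of
  total resistance at most \<open>R\<close>, so each of the at most \<open>(2 m + 1)\<^sup>2\<close> terms of the variance is at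
  most \<open>R\<close> times the energy. One of the two cardinality factors is the normalization in the
  Poincare constant.\<close>

lemma spectral_gap_ge_path:
  assumes z: "\<And>i. z i > 0" and \<alpha>: "\<alpha> > 0"
    and I: "box_index z L \<subseteq> {- int m..int m}" "0 \<in> box_index z L" "1 \<in> box_index z L"
    and R: "(\<Sum>k\<in>{- int m..<int m}. exp (z k powr \<alpha>)) \<le> R"
  shows "1 / ((2 * real m + 1) * R) \<le> spectral_gap \<alpha> (renewal_set z) L"
proof -
  let ?x = "renewal_point z" and ?I = "box_index z L"
  have fin: "finite ?I" using I(1) by (rule finite_subset) simp
  have mono: "strict_mono ?x" by (rule renewal_point_strict_mono[OF z])
  have interval: "k \<in> ?I" if "i \<in> ?I" "j \<in> ?I" "i \<le> k" "k \<le> j" for i j k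
  proof -
    have "?x i \<le> ?x k" "?x k \<le> ?x j" using that mono by (simp_all add: strict_mono_less_eq)
    then show ?thesis using that unfolding box_index_def by auto
  qed
  have R0: "0 \<le> R" using R by (rule order_trans[rotated]) (simp add: sum_nonneg)
  have card: "real (card ?I) \<le> 2 * real m + 1"
  proof -
    have "card ?I \<le> card {- int m..int m}" using I by (intro card_mono) auto
    then show ?thesis by simp
  qed
  show ?thesis
  proof (rule spectral_gap_ge[OF _ \<alpha>, where a = "?x 0" and b = "?x 1"])
    show "finite (box_points (renewal_set z) L)" using fin by (simp add: box_points_renewal_set)
    show "?x 0 \<in> box_points (renewal_set z) L" "?x 1 \<in> box_points (renewal_set z) L"
      using I by (auto simp: box_points_renewal_set)
    show "?x 0 \<noteq> ?x 1" using mono by (simp add: strict_mono_eq)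
    fix f :: "real \<Rightarrow> real"
    let ?g = "\<lambda>i. f (?x i)"
    let ?E = "dirichlet_energy \<alpha> (box_points (renewal_set z) L) f"
    let ?T = "\<lambda>i j. exp (- (\<bar>?x i - ?x j\<bar> powr \<alpha>)) * (?g i - ?g j)\<^sup>2"
    have E0: "0 \<le> ?E" unfolding dirichlet_energy_def by (intro sum_nonneg) auto
    have le: "(?g j - ?g i)\<^sup>2 \<le> R * ?E" if ij: "i \<in> ?I" "j \<in> ?I" "i \<le> j" for i j
    proof -
      have "(?g j - ?g i)\<^sup>2 \<le> (\<Sum>k\<in>{i..<j}. exp (z k powr \<alpha>)) * (\<Sum>k\<in>{i..<j}. exp (- (z k powr \<alpha>)) * (?g (k + 1) - ?g k)\<^sup>2)"
        using path_inequality[OF ij(3), of ?g "\<lambda>k. z k powr \<alpha>"] by simp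
      also have "\<dots> \<le> R * ?E"
      proof (intro mult_mono)
        have "{i..<j} \<subseteq> {- int m..<int m}" using ij I by auto
        then have "(\<Sum>k\<in>{i..<j}. exp (z k powr \<alpha>)) \<le> (\<Sum>k\<in>{- int m..<int m}. exp (z k powr \<alpha>))"
          by (intro sum_mono2) auto
        with R show "(\<Sum>k\<in>{i..<j}. exp (z k powr \<alpha>)) \<le> R" by simp
        have "(\<Sum>k\<in>{i..<j}. exp (- (z k powr \<alpha>)) * (?g (k + 1) - ?g k)\<^sup>2) = (\<Sum>k\<in>{i..<j}. ?T (k + 1) k)"
          using z by (simp add: renewal_point_Suc less_imp_le)
        also have "\<dots> = (\<Sum>k\<in>(\<lambda>k. k + 1) ` {i..<j}. ?T k (k - 1))"
          by (subst sum.reindex) (auto simp: inj_on_def)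
        also have "\<dots> \<le> (\<Sum>k\<in>(\<lambda>k. k + 1) ` {i..<j}. \<Sum>l\<in>?I. ?T k l)"
        proof (intro sum_mono)
          fix k assume k: "k \<in> (\<lambda>k. k + 1) ` {i..<j}"
          then have "i \<le> k - 1" "k - 1 \<le> j" by auto
          then have "k - 1 \<in> ?I" by (rule interval[OF ij(1,2)])
          then show "?T k (k - 1) \<le> (\<Sum>l\<in>?I. ?T k l)"
            using fin by (intro member_le_sum) auto
        qed
        also have "\<dots> \<le> (\<Sum>k\<in>?I. \<Sum>l\<in>?I. ?T k l)"
        proof (intro sum_mono2 fin)
          show "(\<lambda>k. k + 1) ` {i..<j} \<subseteq> ?I"
            by (auto intro!: interval[OF ij(1,2)])
        qed (auto intro!: sum_nonneg)
        also have "\<dots> = ?E" by (rule dirichlet_energy_box[OF z, symmetric])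
        finally show "(\<Sum>k\<in>{i..<j}. exp (- (z k powr \<alpha>)) * (?g (k + 1) - ?g k)\<^sup>2) \<le> ?E" .
      qed (use R0 in \<open>auto intro!: sum_nonneg\<close>)
      finally show ?thesis .
    qed
    have le': "(?g i - ?g j)\<^sup>2 \<le> R * ?E" if "i \<in> ?I" "j \<in> ?I" for i j
      using le[of i j] le[of j i] that by (cases "i \<le> j") (auto simp: power2_commute)
    have "total_variance (box_points (renewal_set z) L) f \<le> (\<Sum>i\<in>?I. \<Sum>j\<in>?I. R * ?E)"
      unfolding total_variance_box[OF z] using le' by (intro sum_mono) auto
    also have "\<dots> = card ?I * (R * card ?I * ?E)" by simp
    also have "\<dots> \<le> (2 * real m + 1) * (R * card ?I * ?E)"
      using card R0 E0 by (intro mult_right_mono) auto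
    finally show "total_variance (box_points (renewal_set z) L) f \<le>
      (2 * real m + 1) * R * real (card (box_points (renewal_set z) L)) * ?E"
      by (simp add: card_box_points[OF z] mult.assoc)
  qed
qed

section \<open>The cut at a large spacing\<close>

text \<open>For \<open>\<alpha> \<ge> 1\<close> compare each summand \<open>x\<^sup>\<alpha>\<close> with \<open>x s\<^sup>\<alpha>\<^sup>-\<^sup>1\<close>, where \<open>s\<close> is the total. For \<open>\<alpha> < 1\<close> the power is
  concave, and the tangent at \<open>s / 3\<close> (an instance of Young's inequality) gives the power mean
  inequality, hence the constant \<open>3\<^sup>\<alpha>\<^sup>-\<^sup>1\<close>.\<close>

lemma powr_superadditive3:
  fixes g u v \<alpha> :: real
  assumes nn: "0 \<le> g" "0 \<le> u" "0 \<le> v" and \<alpha>: "0 < \<alpha>"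
  shows "min 1 (3 powr (\<alpha> - 1)) * (g powr \<alpha> + u powr \<alpha> + v powr \<alpha>) \<le> (g + u + v) powr \<alpha>"
proof (cases "g + u + v = 0")
  case True
  then have "g = 0" "u = 0" "v = 0" using nn by linarith+
  then show ?thesis by simp
next
  case False
  define s where "s = g + u + v"
  have s: "s > 0" using False nn by (simp add: s_def)
  show ?thesis
  proof (cases "\<alpha> \<ge> 1")
    case True
    have le: "x powr \<alpha> \<le> x * s powr (\<alpha> - 1)" if "0 \<le> x" "x \<le> s" for x
    proof (cases "x = 0")
      case False
      have "x powr \<alpha> = x * x powr (\<alpha> - 1)" using False that by (simp add: powr_mult_base)
      also have "\<dots> \<le> x * s powr (\<alpha> - 1)" using that True by (intro mult_left_mono powr_mono2) auto
      finally show ?thesis .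
    qed simp
    have "min 1 (3 powr (\<alpha> - 1)) * (g powr \<alpha> + u powr \<alpha> + v powr \<alpha>) \<le> 1 * (g powr \<alpha> + u powr \<alpha> + v powr \<alpha>)"
      by (intro mult_right_mono) auto
    also have "\<dots> \<le> s * s powr (\<alpha> - 1)"
      using le[of g] le[of u] le[of v] nn unfolding s_def by (simp add: distrib_right)
    also have "\<dots> = s powr \<alpha>" using s by (simp add: powr_mult_base)
    finally show ?thesis by (simp add: s_def)
  next
    case False
    define t where "t = s / 3"
    have t: "t > 0" using s by (simp add: t_def)
    have le: "x powr \<alpha> \<le> t powr (\<alpha> - 1) * (\<alpha> * x + (1 - \<alpha>) * t)" if "0 \<le> x" for x
    proof (cases "x = 0")
      case False
      have "x powr \<alpha> = t powr (\<alpha> - 1) * (x powr \<alpha> * t powr (1 - \<alpha>))"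
        using t by (simp add: powr_add[symmetric])
      also have "\<dots> \<le> t powr (\<alpha> - 1) * (\<alpha> * x + (1 - \<alpha>) * t)"
        using False that t \<alpha> \<open>\<not> \<alpha> \<ge> 1\<close> by (intro mult_left_mono Youngs_inequality_0) auto
      finally show ?thesis .
    qed (use t \<open>\<not> \<alpha> \<ge> 1\<close> in simp)
    have "g powr \<alpha> + u powr \<alpha> + v powr \<alpha> \<le> t powr (\<alpha> - 1) * (\<alpha> * s + 3 * (1 - \<alpha>) * t)"
      using le[of g] le[of u] le[of v] nn unfolding s_def by (simp add: algebra_simps)
    also have "\<dots> = t powr (\<alpha> - 1) * s" by (simp add: t_def algebra_simps)
    finally have "min 1 (3 powr (\<alpha> - 1)) * (g powr \<alpha> + u powr \<alpha> + v powr \<alpha>) \<le> 3 powr (\<alpha> - 1) * (t powr (\<alpha> - 1) * s)"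
      by (intro mult_mono) auto
    also have "\<dots> = (3 * t) powr (\<alpha> - 1) * s" using t by (simp add: powr_mult)
    also have "\<dots> = s powr \<alpha>" using s powr_mult_base[of s "\<alpha> - 1"] by (simp add: t_def mult.commute)
    finally show ?thesis by (simp add: s_def)
  qed
qed

text \<open>At most \<open>l\<close> indices have the same quotient by \<open>l\<close>.\<close>

lemma sum_block_le:
  fixes f :: "'b \<Rightarrow> real" and h :: "nat \<Rightarrow> real"
  assumes "finite A" "inj_on a A" "\<And>i. i \<in> A \<Longrightarrow> f i \<le> h (a i div l)" and h: "\<And>q. 0 \<le> h q" "summable h" and l: "0 < l"
  shows "sum f A \<le> real l * suminf h"
proof -
  have "finite (a ` A)" using assms(1) by simp
  then obtain N where N: "a ` A \<subseteq> {..<N}" using finite_nat_iff_bounded by blast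
  have "sum f A \<le> (\<Sum>i\<in>A. h (a i div l))" using assms(3) by (rule sum_mono)
  also have "\<dots> = (\<Sum>b\<in>a ` A. h (b div l))" using assms(2) by (simp add: sum.reindex)
  also have "\<dots> \<le> (\<Sum>b<N * l. h (b div l))"
  proof (rule sum_mono2)
    have "N \<le> N * l" using l by simp
    then have "{..<N} \<subseteq> {..<N * l}" by auto
    with N show "a ` A \<subseteq> {..<N * l}" by (rule order_trans)
  qed (use h in auto)
  also have "\<dots> = (\<Sum>q<N. \<Sum>b\<in>{q * l..<q * l + l}. h (b div l))" by (rule sum.nat_group[symmetric])
  also have "\<dots> = (\<Sum>q<N. \<Sum>b\<in>{q * l..<q * l + l}. h q)"
  proof (intro sum.cong refl)
    fix q b assume "b \<in> {q * l..<q * l + l}"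
    then have "b div l = q" using l by (intro div_nat_eqI) (auto simp: mult.commute)
    then show "h (b div l) = h q" by simp
  qed
  also have "\<dots> = real l * (\<Sum>q<N. h q)" by (simp add: sum_distrib_left)
  also have "\<dots> \<le> real l * suminf h" using h by (intro mult_left_mono sum_le_suminf) auto
  finally show ?thesis .
qed

text \<open>Every complete window of \<open>l\<close> consecutive spacings contributes at least \<open>\<delta>\<close> to the distance.\<close>

lemma renewal_point_diff_windows:
  assumes z: "\<And>i. z i > 0" and l: "0 < l"
    and win: "\<And>k. k \<in> {- int m..int m} \<Longrightarrow> \<exists>i\<in>{k..<k + int l}. z i > \<delta>"
    and ij: "- int m \<le> i" "j \<le> int m" "i + int (q * l) \<le> j"
  shows "\<delta> * real q \<le> renewal_point z j - renewal_point z i"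
  using ij
proof (induction q arbitrary: i)
  case 0
  then show ?case using renewal_point_strict_mono[OF z] by (simp add: strict_mono_less_eq)
next
  case (Suc q)
  have q: "i + int l + int (q * l) \<le> j" using Suc.prems(3) by (simp add: algebra_simps)
  have "0 \<le> int (q * l)" by simp
  then have "i + int l \<le> j" using q by linarith
  then have "i \<in> {- int m..int m}" using Suc.prems by auto
  then obtain k where k: "k \<in> {i..<i + int l}" "z k > \<delta>" using win by blast
  have "\<delta> < z k" by fact
  also have "z k \<le> (\<Sum>k\<in>{i..<i + int l}. z k)"
    using k z by (intro member_le_sum) (auto simp: less_imp_le)
  also have "\<dots> = renewal_point z (i + int l) - renewal_point z i"
    by (rule renewal_point_diff[symmetric]) simp
  finally have "\<delta> < renewal_point z (i + int l) - renewal_point z i" .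
  moreover have "\<delta> * real q \<le> renewal_point z j - renewal_point z (i + int l)"
    using Suc.IH[of "i + int l"] Suc.prems q by simp
  ultimately show ?case by (simp add: algebra_simps)
qed

text \<open>The test function is the indicator of the points to the right of spacing number \<open>c\<close>. A jump
  across the spacing decomposes into the spacing itself and the distances \<open>u\<close>, \<open>v\<close> from its two ends to the
  endpoints of the jump, so its rate is at most the product of \<open>exp (- d z\<^sub>c\<^sup>\<alpha>)\<close>, \<open>exp (- d u\<^sup>\<alpha>)\<close> and
  \<open>exp (- d v\<^sup>\<alpha>)\<close>. The sums over \<open>u\<close> and over \<open>v\<close> separate, and each is at most \<open>l H\<close> because at most \<open>l\<close>
  points fit in every step of length \<open>\<delta>\<close>. The variance is \<open>2 a b\<close> for \<open>a\<close> points on the left and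
  \<open>b\<close> on the right; normalized by \<open>a + b\<close> it yields \<open>1 / a + 1 / b\<close>, so the cut must not be close to the
  boundary of the box.\<close>

lemma spectral_gap_le_cut:
  assumes z: "\<And>i. z i > 0" and \<alpha>: "\<alpha> > 0" and \<delta>: "\<delta> > 0" and l: "0 < l"
    and win: "\<And>k. k \<in> {- int m..int m} \<Longrightarrow> \<exists>i\<in>{k..<k + int l}. z i > \<delta>"
    and I: "box_index z L \<subseteq> {- int m..int m}" "{- int p..int p} \<subseteq> box_index z L"
    and c: "\<bar>c\<bar> + int q + 1 \<le> int p" and q: "0 < q"
  defines "d \<equiv> min 1 (3 powr (\<alpha> - 1))"
  defines "H \<equiv> (\<Sum>n. exp (- (d * (\<delta> * real n) powr \<alpha>)))"
  shows "spectral_gap \<alpha> (renewal_set z) L \<le> 2 / real q * (real l * H)\<^sup>2 * exp (- (d * z c powr \<alpha>))"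
proof -
  let ?x = "renewal_point z" and ?I = "box_index z L"
  define A where "A = {i\<in>?I. i \<le> c}"
  define B where "B = {i\<in>?I. c < i}"
  define h where "h = (\<lambda>i. of_bool (c < i) :: real)"
  define w where "w = (\<lambda>i j. exp (- (\<bar>?x i - ?x j\<bar> powr \<alpha>)))"
  define f where "f = (\<lambda>n::nat. exp (- (d * (\<delta> * real n) powr \<alpha>)))"
  have d: "0 < d" by (simp add: d_def)
  have fin: "finite ?I" using I(1) by (rule finite_subset) simp
  have mono: "?x i \<le> ?x j" if "i \<le> j" for i j
    using renewal_point_strict_mono[OF z] that by (simp add: strict_mono_less_eq)
  have AB: "?I = A \<union> B" "A \<inter> B = {}" "finite A" "finite B" using fin by (auto simp: A_def B_def)
  have split: "sum F ?I = sum F A + sum F B" for F :: "int \<Rightarrow> real"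
    unfolding AB(1) using AB(2-) by (simp add: sum.union_disjoint)
  have hA: "h i = 0" if "i \<in> A" for i using that by (simp add: A_def h_def)
  have hB: "h i = 1" if "i \<in> B" for i using that by (simp add: B_def h_def)
  have double: "(\<Sum>i\<in>?I. \<Sum>j\<in>?I. K i j * (h i - h j)\<^sup>2) = (\<Sum>i\<in>A. \<Sum>j\<in>B. K i j) + (\<Sum>i\<in>B. \<Sum>j\<in>A. K i j)"
    for K :: "int \<Rightarrow> int \<Rightarrow> real"
    unfolding split by (simp add: hA hB)
  have f: "summable f"
  proof -
    have "summable (\<lambda>n::nat. real n ^ 0 * exp (- (d * \<delta> powr \<alpha> * real n powr \<alpha>)))"
      using d \<delta> \<alpha> by (intro summable_stretched_exp) auto
    then show ?thesis unfolding f_def using \<delta> by (simp add: powr_mult mult.assoc)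
  qed
  have H: "H = suminf f" by (simp add: H_def f_def)
  have f_le: "exp (- (d * r powr \<alpha>)) \<le> f n" if "\<delta> * real n \<le> r" for r n
    unfolding f_def using that \<delta> d \<alpha> by (auto intro!: mult_left_mono powr_mono2)
  have sumA: "(\<Sum>i\<in>A. exp (- (d * (?x c - ?x i) powr \<alpha>))) \<le> real l * H"
    unfolding H
  proof (rule sum_block_le[where a = "\<lambda>i. nat (c - i)" and h = f])
    fix i assume i: "i \<in> A"
    then have "i \<le> c" "- int m \<le> i" using I by (auto simp: A_def)
    have "int (nat (c - i) div l * l) \<le> int (nat (c - i))" by (metis div_times_less_eq_dividend of_nat_le_iff)
    then have "i + int (nat (c - i) div l * l) \<le> c" using \<open>i \<le> c\<close> by simp
    moreover have "c \<le> int m" using c I by (force simp: subset_iff)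
    ultimately show "exp (- (d * (?x c - ?x i) powr \<alpha>)) \<le> f (nat (c - i) div l)"
      using \<open>- int m \<le> i\<close> by (intro f_le renewal_point_diff_windows[OF z l win])
  qed (use AB f l in \<open>auto simp: A_def inj_on_def f_def\<close>)
  have sumB: "(\<Sum>j\<in>B. exp (- (d * (?x j - ?x (c + 1)) powr \<alpha>))) \<le> real l * H"
    unfolding H
  proof (rule sum_block_le[where a = "\<lambda>j. nat (j - (c + 1))" and h = f])
    fix j assume j: "j \<in> B"
    then have "c + 1 \<le> j" "j \<le> int m" using I by (auto simp: B_def)
    have "int (nat (j - (c + 1)) div l * l) \<le> int (nat (j - (c + 1)))" by (metis div_times_less_eq_dividend of_nat_le_iff)
    then have "c + 1 + int (nat (j - (c + 1)) div l * l) \<le> j" using \<open>c + 1 \<le> j\<close> by simp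
    moreover have "- int m \<le> c + 1" using c I by (force simp: subset_iff)
    ultimately show "exp (- (d * (?x j - ?x (c + 1)) powr \<alpha>)) \<le> f (nat (j - (c + 1)) div l)"
      using \<open>j \<le> int m\<close> by (intro f_le renewal_point_diff_windows[OF z l win])
  qed (use AB f l in \<open>auto simp: B_def inj_on_def f_def\<close>)
  have w: "w i j \<le> exp (- (d * z c powr \<alpha>)) * exp (- (d * (?x c - ?x i) powr \<alpha>)) * exp (- (d * (?x j - ?x (c + 1)) powr \<alpha>))"
    if "i \<in> A" "j \<in> B" for i j
  proof -
    have ij: "i \<le> c" "c + 1 \<le> j" using that by (auto simp: A_def B_def)
    have "d * (z c powr \<alpha> + (?x c - ?x i) powr \<alpha> + (?x j - ?x (c + 1)) powr \<alpha>)
       \<le> (z c + (?x c - ?x i) + (?x j - ?x (c + 1))) powr \<alpha>"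
      unfolding d_def using z[of c] mono[OF ij(1)] mono[OF ij(2)] \<alpha> by (intro powr_superadditive3) auto
    also have "z c + (?x c - ?x i) + (?x j - ?x (c + 1)) = ?x j - ?x i" by (simp add: renewal_point_Suc)
    also have "\<dots> = \<bar>?x i - ?x j\<bar>" using mono[of i j] ij by simp
    finally show ?thesis unfolding w_def by (simp add: exp_add[symmetric] algebra_simps)
  qed
  define E where "E = exp (- (d * z c powr \<alpha>)) * (real l * H)\<^sup>2"
  have H0: "0 \<le> H" unfolding H using f by (rule suminf_nonneg) (simp add: f_def)
  have wE: "(\<Sum>i\<in>A. \<Sum>j\<in>B. w i j) \<le> E"
  proof -
    have "(\<Sum>i\<in>A. \<Sum>j\<in>B. w i j) \<le> (\<Sum>i\<in>A. \<Sum>j\<in>B. exp (- (d * z c powr \<alpha>)) * exp (- (d * (?x c - ?x i) powr \<alpha>)) * exp (- (d * (?x j - ?x (c + 1)) powr \<alpha>)))"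
      using w by (intro sum_mono) auto
    also have "\<dots> = exp (- (d * z c powr \<alpha>)) * ((\<Sum>i\<in>A. exp (- (d * (?x c - ?x i) powr \<alpha>))) * (\<Sum>j\<in>B. exp (- (d * (?x j - ?x (c + 1)) powr \<alpha>))))"
      unfolding sum_product by (simp add: sum_distrib_left mult.assoc)
    also have "\<dots> \<le> exp (- (d * z c powr \<alpha>)) * ((real l * H) * (real l * H))"
      using sumA sumB H0 by (intro mult_left_mono mult_mono) (auto intro!: sum_nonneg)
    finally show ?thesis by (simp add: E_def power2_eq_square)
  qed
  have "(\<Sum>i\<in>B. \<Sum>j\<in>A. w i j) = (\<Sum>i\<in>A. \<Sum>j\<in>B. w i j)"
    by (subst sum.swap) (simp add: w_def abs_minus_commute)
  then have e: "(\<Sum>i\<in>?I. \<Sum>j\<in>?I. w i j * (h i - h j)\<^sup>2) \<le> 2 * E" unfolding double using wE by simp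
  have qA: "q \<le> card A"
  proof -
    have "{c - int q + 1..c} \<subseteq> {- int p..int p}" using c by auto
    then have "{c - int q + 1..c} \<subseteq> A" unfolding A_def using I(2) by auto
    then have "card {c - int q + 1..c} \<le> card A" using AB by (intro card_mono) auto
    then show ?thesis by simp
  qed
  have qB: "q \<le> card B"
  proof -
    have "{c + 1..c + int q} \<subseteq> {- int p..int p}" using c by auto
    then have "{c + 1..c + int q} \<subseteq> B" unfolding B_def using I(2) by auto
    then have "card {c + 1..c + int q} \<le> card B" using AB by (intro card_mono) auto
    then show ?thesis by simp
  qed
  define a b where "a = real (card A)" and "b = real (card B)"
  have ab: "real q \<le> a" "real q \<le> b" using qA qB by (simp_all add: a_def b_def)
  have ab0: "0 < a" "0 < b" using ab q by linarith+
  have v: "(\<Sum>i\<in>?I. \<Sum>j\<in>?I. (h i - h j)\<^sup>2) = 2 * a * b"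
    using double[of "\<lambda>_ _. 1"] by (simp add: a_def b_def)
  have "card ?I = card A + card B" unfolding AB(1) using AB by (intro card_Un_disjoint)
  then have card: "real (card ?I) = a + b" by (simp add: a_def b_def)
  have "spectral_gap \<alpha> (renewal_set z) L \<le> real (card ?I) * (2 * E) / (2 * a * b)"
    using ab0 v e unfolding w_def
    by (intro spectral_gap_le_index_test_function[where h = h, OF z fin \<alpha>]) auto
  also have "\<dots> = (1 / a + 1 / b) * E" using ab0 by (simp add: card field_simps)
  also have "\<dots> \<le> (1 / real q + 1 / real q) * E"
    using ab ab0 q by (intro mult_right_mono add_mono divide_left_mono) (auto simp: E_def)
  finally show ?thesis by (simp add: E_def mult_ac)
qed

section \<open>The linear test function\<close>

lemma sum_int_le_two_sided:
  fixes g :: "int \<Rightarrow> real"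
  assumes g: "\<And>i. 0 \<le> g i" and I: "I \<subseteq> {- int m..int m}"
  shows "sum g I \<le> (\<Sum>a<Suc m. g (int a)) + (\<Sum>a<Suc m. g (- int a))"
proof -
  let ?R = "int ` {..<Suc m}" and ?L = "(\<lambda>a. - int a) ` {..<Suc m}"
  have cover: "{- int m..int m} \<subseteq> ?R \<union> ?L"
  proof
    fix k assume k: "k \<in> {- int m..int m}"
    show "k \<in> ?R \<union> ?L"
    proof (cases "0 \<le> k")
      case True
      then show ?thesis using k by (intro UnI1 image_eqI[of _ _ "nat k"]) auto
    next
      case False
      then show ?thesis using k by (intro UnI2 image_eqI[of _ _ "nat (- k)"]) auto
    qed
  qed
  have "sum g I \<le> sum g (?R \<union> ?L)" using I cover g by (intro sum_mono2) auto
  also have "\<dots> \<le> sum g ?R + sum g ?L"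
    using sum.union_inter[of ?R ?L g] sum_nonneg[of "?R \<inter> ?L" g] g by simp
  also have "\<dots> = (\<Sum>a<Suc m. g (int a)) + (\<Sum>a<Suc m. g (- int a))"
    by (subst (1 2) sum.reindex) (auto simp: inj_on_def)
  finally show ?thesis .
qed

text \<open>Each unordered pair is counted twice on the left and at least once, from its left endpoint, on the
  right.\<close>

lemma half_line_energy_le:
  fixes s :: "nat \<Rightarrow> real"
  assumes s: "\<And>i. s i > 0"
  shows "(\<Sum>a<n. \<Sum>b<n. exp (- (\<bar>sum s {..<a} - sum s {..<b}\<bar> powr \<alpha>)) * (real a - real b)\<^sup>2)
    \<le> 2 * (\<Sum>k<n. \<Sum>d<n. jump_energy \<alpha> (\<lambda>i. s (i + k)) d)"
proof -
  define w where "w = (\<lambda>a b. exp (- (\<bar>sum s {..<a} - sum s {..<b}\<bar> powr \<alpha>)) * (real a - real b)\<^sup>2)"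
  define u where "u = (\<lambda>a b. if a < b then w a b else 0)"
  have sym: "w a b = w b a" for a b by (simp add: w_def abs_minus_commute power2_commute)
  have eq: "w a b = u a b + u b a" for a b
  proof -
    consider "a < b" | "a = b" | "b < a" by linarith
    then show ?thesis
    proof cases
      case 2 then show ?thesis by (simp add: u_def w_def)
    next
      case 3 then show ?thesis using sym[of a b] by (simp add: u_def)
    qed (simp add: u_def)
  qed
  have diff: "sum s {..<k + d} = sum s {..<k} + (\<Sum>i<d. s (i + k))" for k d
    by (induction d) (simp_all add: add.commute)
  have jump: "w k (k + Suc d) = jump_energy \<alpha> (\<lambda>i. s (i + k)) d" for k d
  proof -
    have "0 \<le> (\<Sum>i<Suc d. s (i + k))" using s by (intro sum_nonneg) (auto simp: less_imp_le)
    then have "\<bar>sum s {..<k} - sum s {..<k + Suc d}\<bar> = (\<Sum>i<Suc d. s (i + k))"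
      by (simp only: diff)
    moreover have "(real k - real (k + Suc d))\<^sup>2 = (real (Suc d))\<^sup>2"
      by (subst power2_commute) simp
    ultimately show ?thesis unfolding w_def jump_energy_def by (simp only: mult.commute)
  qed
  have row: "(\<Sum>b<n. u k b) \<le> (\<Sum>d<n. jump_energy \<alpha> (\<lambda>i. s (i + k)) d)" for k
  proof -
    have "(\<Sum>b<n. u k b) = (\<Sum>b\<in>{k<..<n}. w k b)"
      by (rule sum.mono_neutral_cong_right) (auto simp: u_def)
    also have "\<dots> \<le> (\<Sum>b\<in>(\<lambda>d. k + Suc d) ` {..<n}. w k b)"
    proof (rule sum_mono2)
      show "{k<..<n} \<subseteq> (\<lambda>d. k + Suc d) ` {..<n}"
      proof
        fix b assume "b \<in> {k<..<n}"
        then show "b \<in> (\<lambda>d. k + Suc d) ` {..<n}" by (intro image_eqI[of _ _ "b - Suc k"]) auto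
      qed
    qed (auto simp: w_def)
    also have "\<dots> = (\<Sum>d<n. jump_energy \<alpha> (\<lambda>i. s (i + k)) d)"
      by (subst sum.reindex) (auto simp: inj_on_def jump simp del: add_Suc_right)
    finally show ?thesis .
  qed
  have "(\<Sum>a<n. \<Sum>b<n. w a b) = (\<Sum>a<n. \<Sum>b<n. u a b) + (\<Sum>a<n. \<Sum>b<n. u b a)"
    unfolding eq by (simp add: sum.distrib)
  also have "(\<Sum>a<n. \<Sum>b<n. u b a) = (\<Sum>a<n. \<Sum>b<n. u a b)" by (rule sum.swap)
  also have "(\<Sum>a<n. \<Sum>b<n. u a b) \<le> (\<Sum>k<n. \<Sum>d<n. jump_energy \<alpha> (\<lambda>i. s (i + k)) d)"
    by (intro sum_mono row)
  finally show ?thesis unfolding w_def by simp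
qed

text \<open>Half of the exponent is given away so that a jump over the origin can be bounded by a product of a
  weight for its right endpoint and a weight for its left endpoint.\<close>

definition tail_weight :: "real \<Rightarrow> (nat \<Rightarrow> real) \<Rightarrow> nat \<Rightarrow> real" where
  "tail_weight \<alpha> s a = (real a + 1)\<^sup>2 * exp (- (sum s {..<a} powr \<alpha> / 2))"

lemma tail_weight_nonneg: "0 \<le> tail_weight \<alpha> s a"
  by (simp add: tail_weight_def)

lemma tail_weight_summable:
  assumes c: "c > 0" and \<alpha>: "\<alpha> > 0" and ev: "\<forall>\<^sub>F n in sequentially. c * real n \<le> sum s {..<n}"
  shows "summable (tail_weight \<alpha> s)"
proof (rule summable_comparison_test_ev)
  show "summable (\<lambda>n. 4 * (real n ^ 2 * exp (- (c powr \<alpha> / 2 * real n powr \<alpha>))))"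
    using c \<alpha> by (intro summable_mult summable_stretched_exp) auto
  show "\<forall>\<^sub>F n in sequentially. norm (tail_weight \<alpha> s n) \<le> 4 * (real n ^ 2 * exp (- (c powr \<alpha> / 2 * real n powr \<alpha>)))"
    using ev eventually_ge_at_top[of 1]
  proof eventually_elim
    case (elim n)
    have "(c * real n) powr \<alpha> \<le> sum s {..<n} powr \<alpha>" using elim c \<alpha> by (intro powr_mono2) auto
    then have e: "exp (- (sum s {..<n} powr \<alpha> / 2)) \<le> exp (- (c powr \<alpha> / 2 * real n powr \<alpha>))"
      using c by (simp add: powr_mult)
    have "(real n + 1)\<^sup>2 \<le> (2 * real n)\<^sup>2" using elim by (intro power_mono) auto
    then have "(real n + 1)\<^sup>2 \<le> 4 * real n ^ 2" by (simp add: power_mult_distrib)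
    then have "tail_weight \<alpha> s n \<le> (4 * real n ^ 2) * exp (- (c powr \<alpha> / 2 * real n powr \<alpha>))"
      unfolding tail_weight_def using e by (intro mult_mono) auto
    then show ?case using tail_weight_nonneg[of \<alpha> s n] by (simp add: mult.assoc)
  qed
qed

text \<open>The length of the jump is at least either distance to the origin, so its power is at least the
  average of the two powers; and \<open>a + b \<le> (a + 1) (b + 1)\<close>.\<close>

lemma mixed_energy_le:
  fixes s t :: "nat \<Rightarrow> real"
  assumes s: "\<And>i. s i > 0" and t: "\<And>i. t i > 0" and \<alpha>: "\<alpha> > 0"
  shows "exp (- ((sum s {..<a} + sum t {..<b}) powr \<alpha>)) * (real a + real b)\<^sup>2 \<le> tail_weight \<alpha> s a * tail_weight \<alpha> t b"
proof -
  have nn: "0 \<le> sum s {..<a}" "0 \<le> sum t {..<b}" using s t by (auto intro!: sum_nonneg simp: less_imp_le)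
  have "sum s {..<a} powr \<alpha> \<le> (sum s {..<a} + sum t {..<b}) powr \<alpha>"
    "sum t {..<b} powr \<alpha> \<le> (sum s {..<a} + sum t {..<b}) powr \<alpha>"
    using nn \<alpha> by (auto intro!: powr_mono2)
  then have "exp (- ((sum s {..<a} + sum t {..<b}) powr \<alpha>)) \<le> exp (- (sum s {..<a} powr \<alpha> / 2) + - (sum t {..<b} powr \<alpha> / 2))"
    unfolding exp_le_cancel_iff by linarith
  moreover have "(real a + real b)\<^sup>2 \<le> ((real a + 1) * (real b + 1))\<^sup>2"
    by (intro power_mono) (auto simp: algebra_simps)
  ultimately have "exp (- ((sum s {..<a} + sum t {..<b}) powr \<alpha>)) * (real a + real b)\<^sup>2
    \<le> exp (- (sum s {..<a} powr \<alpha> / 2) + - (sum t {..<b} powr \<alpha> / 2)) * ((real a + 1) * (real b + 1))\<^sup>2"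
    by (intro mult_mono) auto
  also have "\<dots> = tail_weight \<alpha> s a * tail_weight \<alpha> t b"
    unfolding tail_weight_def exp_add power_mult_distrib by (simp only: mult_ac)
  finally show ?thesis .
qed

text \<open>The test function is \<open>x\<^sub>k \<mapsto> k\<close>. Jumps within one half-line are controlled by the one-sided jump
  energies. Jumps over the origin, which these miss, have a total energy that is bounded independently
  of the box.\<close>

lemma spectral_gap_le_linear:
  fixes z :: "int \<Rightarrow> real"
  defines "s \<equiv> \<lambda>i. z (int i)" and "t \<equiv> \<lambda>i. z (- 1 - int i)"
  assumes z: "\<And>i. z i > 0" and \<alpha>: "\<alpha> > 0"
    and I: "box_index z L \<subseteq> {- int m..int m}" "{- int (2 * q)..int (2 * q)} \<subseteq> box_index z L" and q: "0 < q"
    and Es: "(\<Sum>k<Suc m. \<Sum>d<Suc m. jump_energy \<alpha> (\<lambda>i. s (i + k)) d) \<le> Es"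
    and Et: "(\<Sum>k<Suc m. \<Sum>d<Suc m. jump_energy \<alpha> (\<lambda>i. t (i + k)) d) \<le> Et"
    and sum: "summable (tail_weight \<alpha> s)" "summable (tail_weight \<alpha> t)"
  shows "spectral_gap \<alpha> (renewal_set z) L
    \<le> (2 * real m + 1) * (2 * Es + 2 * Et + 2 * suminf (tail_weight \<alpha> s) * suminf (tail_weight \<alpha> t)) / real q ^ 4"
proof -
  let ?x = "renewal_point z" and ?I = "box_index z L" and ?N = "Suc m"
  define e where "e = 2 * Es + 2 * Et + 2 * suminf (tail_weight \<alpha> s) * suminf (tail_weight \<alpha> t)"
  define w where "w = (\<lambda>i j. exp (- (\<bar>?x i - ?x j\<bar> powr \<alpha>)) * (real_of_int i - real_of_int j)\<^sup>2)"
  have s0: "s i > 0" "t i > 0" for i by (simp_all add: s_def t_def z)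
  have fin: "finite ?I" using I(1) by (rule finite_subset) simp
  have xs: "?x (int a) = sum s {..<a}" for a by (simp add: renewal_point_right s_def)
  have xt: "?x (- int b) = - sum t {..<b}" for b
    using renewal_point_right[of "\<lambda>i. z (- 1 - i)" b] renewal_point_reflect[of z "int b"] by (simp add: t_def)
  have nn: "0 \<le> sum s {..<a}" "0 \<le> sum t {..<a}" for a using s0 by (auto intro!: sum_nonneg simp: less_imp_le)
  have w0: "0 \<le> w i j" for i j by (simp add: w_def)
  have pp: "(\<Sum>a<?N. \<Sum>b<?N. w (int a) (int b)) \<le> 2 * Es"
  proof -
    have "w (int a) (int b) = exp (- (\<bar>sum s {..<a} - sum s {..<b}\<bar> powr \<alpha>)) * (real a - real b)\<^sup>2" for a b
      by (simp add: w_def xs)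
    then show ?thesis using half_line_energy_le[of s \<alpha> ?N, OF s0(1)] Es
      by (simp only:)
  qed
  have mm: "(\<Sum>a<?N. \<Sum>b<?N. w (- int a) (- int b)) \<le> 2 * Et"
  proof -
    have "w (- int a) (- int b) = exp (- (\<bar>sum t {..<a} - sum t {..<b}\<bar> powr \<alpha>)) * (real a - real b)\<^sup>2" for a b
      by (simp add: w_def xt abs_minus_commute power2_commute)
    then show ?thesis using half_line_energy_le[of t \<alpha> ?N, OF s0(2)] Et
      by (simp only:)
  qed
  have pm1: "w (int a) (- int b) \<le> tail_weight \<alpha> s a * tail_weight \<alpha> t b" for a b
    using mixed_energy_le[where s = s and t = t and a = a and b = b, OF s0 \<alpha>] nn[of a] nn[of b] unfolding w_def xs xt by simp
  have mp1: "w (- int b) (int a) = w (int a) (- int b)" for a b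
    unfolding w_def by (simp add: abs_minus_commute power2_commute)
  have pm: "(\<Sum>a<?N. \<Sum>b<?N. w (int a) (- int b)) \<le> suminf (tail_weight \<alpha> s) * suminf (tail_weight \<alpha> t)"
  proof -
    have "(\<Sum>a<?N. \<Sum>b<?N. w (int a) (- int b)) \<le> (\<Sum>a<?N. \<Sum>b<?N. tail_weight \<alpha> s a * tail_weight \<alpha> t b)"
      by (intro sum_mono pm1)
    also have "\<dots> = (\<Sum>a<?N. tail_weight \<alpha> s a) * (\<Sum>b<?N. tail_weight \<alpha> t b)" by (rule sum_product[symmetric])
    also have "\<dots> \<le> suminf (tail_weight \<alpha> s) * suminf (tail_weight \<alpha> t)"
      using sum by (intro mult_mono sum_le_suminf suminf_nonneg sum_nonneg) (auto simp: tail_weight_nonneg)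
    finally show ?thesis .
  qed
  have mp: "(\<Sum>a<?N. \<Sum>b<?N. w (- int a) (int b)) \<le> suminf (tail_weight \<alpha> s) * suminf (tail_weight \<alpha> t)"
    using pm by (subst sum.swap) (simp only: mp1)
  have E: "(\<Sum>i\<in>?I. \<Sum>j\<in>?I. w i j) \<le> e"
  proof -
    have row: "(\<Sum>j\<in>?I. w i j) \<le> (\<Sum>b<?N. w i (int b)) + (\<Sum>b<?N. w i (- int b))" for i
      by (rule sum_int_le_two_sided[OF w0 I(1)])
    have "(\<Sum>i\<in>?I. \<Sum>j\<in>?I. w i j) \<le> (\<Sum>i\<in>?I. (\<Sum>b<?N. w i (int b)) + (\<Sum>b<?N. w i (- int b)))"
      by (intro sum_mono row)
    also have "\<dots> \<le> (\<Sum>a<?N. (\<Sum>b<?N. w (int a) (int b)) + (\<Sum>b<?N. w (int a) (- int b)))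
      + (\<Sum>a<?N. (\<Sum>b<?N. w (- int a) (int b)) + (\<Sum>b<?N. w (- int a) (- int b)))"
      by (rule sum_int_le_two_sided[OF _ I(1)]) (intro add_nonneg_nonneg sum_nonneg w0)
    also have "\<dots> \<le> e"
      unfolding e_def sum.distrib using pp mm pm mp by linarith
    finally show ?thesis .
  qed
  have V: "real q ^ 4 \<le> (\<Sum>i\<in>?I. \<Sum>j\<in>?I. (real_of_int i - real_of_int j)\<^sup>2)"
  proof -
    \<comment> \<open>Two blocks of \<open>q\<close> indices at mutual distance at least \<open>q\<close> already give the fourth power.\<close>
    let ?A = "{int q + 1..int (2 * q)}" and ?B = "{- int q..-1}"
    have sub: "?A \<subseteq> ?I" "?B \<subseteq> ?I" using I(2) by (auto simp: subset_iff)
    have "real q ^ 4 = (\<Sum>i\<in>?A. \<Sum>j\<in>?B. (real q)\<^sup>2)" by (simp add: power2_eq_square power4_eq_xxxx)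
    also have "\<dots> \<le> (\<Sum>i\<in>?A. \<Sum>j\<in>?B. (real_of_int i - real_of_int j)\<^sup>2)"
    proof (intro sum_mono power_mono)
      fix i j assume "i \<in> ?A" "j \<in> ?B"
      then have "int q \<le> i - j" by auto
      then show "real q \<le> real_of_int i - real_of_int j" by linarith
    qed auto
    also have "\<dots> \<le> (\<Sum>i\<in>?A. \<Sum>j\<in>?I. (real_of_int i - real_of_int j)\<^sup>2)"
      using sub fin by (intro sum_mono sum_mono2) auto
    also have "\<dots> \<le> (\<Sum>i\<in>?I. \<Sum>j\<in>?I. (real_of_int i - real_of_int j)\<^sup>2)"
      using sub fin by (intro sum_mono2 sum_nonneg) auto
    finally show ?thesis .
  qed
  have card: "real (card ?I) \<le> 2 * real m + 1"
  proof -
    have "card ?I \<le> card {- int m..int m}" using I by (intro card_mono) auto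
    then show ?thesis by simp
  qed
  have e0: "0 \<le> e" using E by (rule order_trans[rotated]) (intro sum_nonneg w0)
  have "spectral_gap \<alpha> (renewal_set z) L \<le> real (card ?I) * e / real q ^ 4"
    using q by (intro spectral_gap_le_index_test_function[OF z fin \<alpha> _ V E[unfolded w_def]]) simp
  also have "\<dots> \<le> (2 * real m + 1) * e / real q ^ 4"
    using card e0 by (intro divide_right_mono mult_right_mono) auto
  finally show ?thesis unfolding e_def .
qed

section \<open>The renewal environment at scale L\<close>

lemma eventually_le_mult_nat:
  fixes c B :: real
  assumes "c > 0"
  shows "\<forall>\<^sub>F L :: nat in sequentially. B \<le> c * real L"
proof -
  have "filterlim (\<lambda>L::nat. c * real L) at_top sequentially" using assms by real_asymp
  then show ?thesis by (simp add: filterlim_at_top)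
qed

text \<open>The law of large numbers puts point number \<open>k\<close> near \<open>\<mu> k\<close>, so the box contains about \<open>L / (2 \<mu>)\<close>
  points on each side. The first bound comes within a factor \<open>\<theta>\<close> of this number, whereas for the
  second a factor of two is given away: \<open>3 / 4\<close> is just some number above \<open>1 / 2\<close>.\<close>

lemma right_index_bounds:
  assumes z: "\<And>i. z i > 0" and \<mu>: "\<mu> > 0" and \<theta>: "0 < \<theta>" "\<theta> < 1"
    and upper: "\<forall>\<^sub>F n in sequentially. renewal_point z (int n) \<le> \<mu> / \<theta> * real n"
    and lower: "\<forall>\<^sub>F n in sequentially. 3 / 4 * \<mu> * real n \<le> renewal_point z (int n)"
  shows "\<forall>\<^sub>F L :: nat in sequentially. \<forall>k. real_of_int k \<le> \<theta> * L / (2 * \<mu>) \<longrightarrow> renewal_point z k \<le> L / 2"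
    and "\<forall>\<^sub>F L :: nat in sequentially. \<forall>k. renewal_point z k \<le> L / 2 \<longrightarrow> real_of_int k \<le> L / \<mu>"
proof -
  have mono: "i \<le> j \<Longrightarrow> renewal_point z i \<le> renewal_point z j" for i j
    using renewal_point_strict_mono[OF z] by (simp add: strict_mono_less_eq)
  obtain N where N: "renewal_point z (int n) \<le> \<mu> / \<theta> * real n" if "n \<ge> N" for n
    using upper unfolding eventually_sequentially by blast
  obtain N' where N': "3 / 4 * \<mu> * real n \<le> renewal_point z (int n)" if "n \<ge> N'" for n
    using lower unfolding eventually_sequentially by blast
  have "\<forall>\<^sub>F L :: nat in sequentially. real N \<le> \<theta> / (2 * \<mu>) * L"
    using \<mu> \<theta> by (intro eventually_le_mult_nat) simp
  then show "\<forall>\<^sub>F L :: nat in sequentially. \<forall>k. real_of_int k \<le> \<theta> * L / (2 * \<mu>) \<longrightarrow> renewal_point z k \<le> L / 2"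
  proof eventually_elim
    case (elim L)
    define m where "m = nat \<lfloor>\<theta> * L / (2 * \<mu>)\<rfloor>"
    have pos: "0 \<le> \<theta> * L / (2 * \<mu>)" using \<mu> \<theta> by simp
    have m: "real m \<le> \<theta> * L / (2 * \<mu>)" unfolding m_def using pos by (simp add: of_nat_floor)
    have "N \<le> m" unfolding m_def using elim by (simp add: le_nat_floor)
    have "renewal_point z (int m) \<le> \<mu> / \<theta> * real m" by (rule N[OF \<open>N \<le> m\<close>])
    also have "\<dots> \<le> \<mu> / \<theta> * (\<theta> * L / (2 * \<mu>))" using m \<mu> \<theta> by (intro mult_left_mono) auto
    also have "\<dots> = L / 2" using \<mu> \<theta> by simp
    finally have le: "renewal_point z (int m) \<le> L / 2" .
    show ?case
    proof (intro allI impI)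
      fix k assume "real_of_int k \<le> \<theta> * L / (2 * \<mu>)"
      then have "k \<le> int m" unfolding m_def using pos by (simp add: le_floor_iff)
      then show "renewal_point z k \<le> L / 2" using mono le by (meson order_trans)
    qed
  qed
  have "\<forall>\<^sub>F L :: nat in sequentially. real N' \<le> 1 / \<mu> * L"
    using \<mu> by (intro eventually_le_mult_nat) simp
  moreover have "\<forall>\<^sub>F L :: nat in sequentially. 0 < L" by (rule eventually_gt_at_top)
  ultimately show "\<forall>\<^sub>F L :: nat in sequentially. \<forall>k. renewal_point z k \<le> L / 2 \<longrightarrow> real_of_int k \<le> L / \<mu>"
  proof eventually_elim
    case (elim L)
    show ?case
    proof (intro allI impI, rule ccontr)
      fix k assume k: "renewal_point z k \<le> L / 2" "\<not> real_of_int k \<le> L / \<mu>"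
      have L0: "0 < L / \<mu>" using elim \<mu> by simp
      define m where "m = nat k"
      have km: "k = int m" using k L0 unfolding m_def by linarith
      have m: "L / \<mu> < real m" using k km by simp
      then have "N' \<le> m" using elim by simp
      from N'[OF this] k km have "3 / 4 * \<mu> * real m \<le> L / 2" by simp
      moreover have "real L < \<mu> * real m" using m \<mu> by (simp add: field_simps)
      ultimately show False using elim by simp
    qed
  qed
qed

lemma box_index_bounds:
  assumes z: "\<And>i. z i > 0" and \<mu>: "\<mu> > 0" and \<theta>: "0 < \<theta>" "\<theta> < 1"
    and right: "\<forall>\<^sub>F n in sequentially. (\<Sum>i<n. z (int i)) \<le> \<mu> / \<theta> * real n"
      "\<forall>\<^sub>F n in sequentially. 3 / 4 * \<mu> * real n \<le> (\<Sum>i<n. z (int i))"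
    and left: "\<forall>\<^sub>F n in sequentially. (\<Sum>i<n. z (- 1 - int i)) \<le> \<mu> / \<theta> * real n"
      "\<forall>\<^sub>F n in sequentially. 3 / 4 * \<mu> * real n \<le> (\<Sum>i<n. z (- 1 - int i))"
  shows "\<forall>\<^sub>F L :: nat in sequentially. {k. \<bar>real_of_int k\<bar> \<le> \<theta> * L / (2 * \<mu>)} \<subseteq> box_index z L"
    and "\<forall>\<^sub>F L :: nat in sequentially. box_index z L \<subseteq> {- int (nat \<lfloor>L / \<mu>\<rfloor>)..int (nat \<lfloor>L / \<mu>\<rfloor>)}"
proof -
  define z' where "z' = (\<lambda>i. z (- 1 - i))"
  have z': "z' i > 0" for i by (simp add: z'_def z)
  have refl: "renewal_point z' k = - renewal_point z (- k)" for k
    unfolding z'_def by (rule renewal_point_reflect)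
  note R = right_index_bounds[of z, OF z \<mu> \<theta> right[folded renewal_point_right]]
  have "\<forall>\<^sub>F n in sequentially. renewal_point z' (int n) \<le> \<mu> / \<theta> * real n"
    "\<forall>\<^sub>F n in sequentially. 3 / 4 * \<mu> * real n \<le> renewal_point z' (int n)"
    unfolding renewal_point_right z'_def using left by simp_all
  note L = right_index_bounds[of z', OF z' \<mu> \<theta> this]
  show "\<forall>\<^sub>F L :: nat in sequentially. {k. \<bar>real_of_int k\<bar> \<le> \<theta> * L / (2 * \<mu>)} \<subseteq> box_index z L"
    using R(1) L(1)
  proof eventually_elim
    case (elim L)
    show ?case
    proof
      fix k assume "k \<in> {k. \<bar>real_of_int k\<bar> \<le> \<theta> * L / (2 * \<mu>)}"
      then have k: "real_of_int k \<le> \<theta> * L / (2 * \<mu>)" "real_of_int (- k) \<le> \<theta> * L / (2 * \<mu>)" by (simp_all add: abs_le_iff)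
      have "renewal_point z k \<le> L / 2" "renewal_point z' (- k) \<le> L / 2" using elim k by blast+
      then show "k \<in> box_index z L" by (simp add: box_index_def refl)
    qed
  qed
  show "\<forall>\<^sub>F L :: nat in sequentially. box_index z L \<subseteq> {- int (nat \<lfloor>L / \<mu>\<rfloor>)..int (nat \<lfloor>L / \<mu>\<rfloor>)}"
    using R(2) L(2)
  proof eventually_elim
    case (elim L)
    show ?case
    proof
      fix k assume "k \<in> box_index z L"
      then have "renewal_point z k \<le> L / 2" "renewal_point z' (- k) \<le> L / 2" by (simp_all add: box_index_def refl)
      with elim have "real_of_int k \<le> L / \<mu>" "real_of_int (- k) \<le> L / \<mu>" by blast+
      then have "k \<le> \<lfloor>L / \<mu>\<rfloor>" "- k \<le> \<lfloor>L / \<mu>\<rfloor>" unfolding le_floor_iff .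
      then show "k \<in> {- int (nat \<lfloor>L / \<mu>\<rfloor>)..int (nat \<lfloor>L / \<mu>\<rfloor>)}" using \<mu> by auto
    qed
  qed
qed

lemma sum_two_sided:
  fixes g :: "int \<Rightarrow> real"
  shows "(\<Sum>k\<in>{- int m..<int m}. g k) = (\<Sum>i<m. g (int i)) + (\<Sum>i<m. g (- 1 - int i))"
proof (induction m)
  case (Suc m)
  have "{- int (Suc m)..<int (Suc m)} = insert (- 1 - int m) (insert (int m) {- int m..<int m})" by auto
  then show ?case using Suc by simp
qed simp

locale renewal_environment = prob_space M for M :: "'a measure" +
  fixes Z :: "int \<Rightarrow> 'a \<Rightarrow> real" and \<alpha> \<mu> :: real
  assumes \<alpha>: "\<alpha> > 0" and iid_Z: "iid Z" and pos: "\<And>i. AE \<omega> in M. Z i \<omega> > 0"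
    and int: "\<And>i. integrable M (Z i)" and mean: "\<And>i. expectation (Z i) = \<mu>"
begin

abbreviation gap :: "'a \<Rightarrow> nat \<Rightarrow> real" where
  "gap \<omega> L \<equiv> spectral_gap \<alpha> (renewal_set (\<lambda>i. Z i \<omega>)) (real L)"

abbreviation width :: "nat \<Rightarrow> nat" where
  "width L \<equiv> nat \<lfloor>real L / \<mu>\<rfloor>"

lemma iid_right: "iid (\<lambda>i::nat. Z (int i))"
  by (rule iid_reindex[OF iid_Z]) (simp add: inj_def)

lemma iid_left: "iid (\<lambda>i::nat. Z (- 1 - int i))"
  by (rule iid_reindex[OF iid_Z]) (simp add: inj_def)

lemma AE_pos: "AE \<omega> in M. \<forall>i. Z i \<omega> > 0"
  using pos by (simp add: AE_all_countable)

lemma mean_pos: "\<mu> > 0"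
proof -
  have "expectation (\<lambda>\<omega>. 0) < expectation (Z 0)"
    using pos[of 0] int[of 0] by (intro integral_less_AE_space) (auto simp: emeasure_space_1)
  then show ?thesis using mean by simp
qed

lemma iid_transform_linear:
  fixes X :: "nat \<Rightarrow> 'a \<Rightarrow> real" and h :: "real \<Rightarrow> real"
  assumes "iid X" and [measurable]: "h \<in> borel_measurable borel" and "integrable M (\<lambda>\<omega>. h (X 0 \<omega>))"
    and "expectation (\<lambda>\<omega>. h (X 0 \<omega>)) < c"
  shows "AE \<omega> in M. \<forall>\<^sub>F n in sequentially. (\<Sum>i<n. h (X i \<omega>)) \<le> c * real n"
proof -
  have "(\<lambda>z. h (z 0)) \<in> borel_measurable (\<Pi>\<^sub>M i\<in>(UNIV::nat set). borel)"
    by (rule measurable_compose[OF measurable_component_singleton]) auto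
  from iid_ergodic_upper[OF assms(1) this] assms(3,4) show ?thesis by simp
qed

lemma AE_box_index:
  fixes \<theta> :: real
  assumes \<theta>: "0 < \<theta>" "\<theta> < 1"
  shows "AE \<omega> in M. \<forall>\<^sub>F L :: nat in sequentially.
      {k. \<bar>real_of_int k\<bar> \<le> \<theta> * L / (2 * \<mu>)} \<subseteq> box_index (\<lambda>i. Z i \<omega>) L \<and>
      box_index (\<lambda>i. Z i \<omega>) L \<subseteq> {- int (width L)..int (width L)}"
proof -
  have c: "\<mu> < \<mu> / \<theta>" "- \<mu> < - (3 / 4 * \<mu>)" using mean_pos \<theta> by (simp_all add: field_simps)
  note lin = iid_transform_linear[OF iid_right, of "\<lambda>x. x"] iid_transform_linear[OF iid_left, of "\<lambda>x. x"]
    iid_transform_linear[OF iid_right, of "\<lambda>x. - x"] iid_transform_linear[OF iid_left, of "\<lambda>x. - x"]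
  have "AE \<omega> in M. \<forall>\<^sub>F n in sequentially. (\<Sum>i<n. Z (int i) \<omega>) \<le> \<mu> / \<theta> * real n"
    "AE \<omega> in M. \<forall>\<^sub>F n in sequentially. (\<Sum>i<n. Z (- 1 - int i) \<omega>) \<le> \<mu> / \<theta> * real n"
    "AE \<omega> in M. \<forall>\<^sub>F n in sequentially. (\<Sum>i<n. - Z (int i) \<omega>) \<le> - (3 / 4 * \<mu>) * real n"
    "AE \<omega> in M. \<forall>\<^sub>F n in sequentially. (\<Sum>i<n. - Z (- 1 - int i) \<omega>) \<le> - (3 / 4 * \<mu>) * real n"
    using c int mean by (intro lin; simp)+
  then show ?thesis using AE_pos
  proof eventually_elim
    case (elim \<omega>)
    show ?case
      using box_index_bounds[of "\<lambda>i. Z i \<omega>" \<mu> \<theta>] elim mean_pos \<theta>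
      by (intro eventually_conj) (simp_all add: sum_negf)
  qed
qed

text \<open>The exponential moment is the mean resistance of a nearest-neighbour bond, so the total resistance
  of the box is of order \<open>L\<close>.\<close>

lemma gap_ge_inverse_square:
  assumes exp_moment: "integrable M (\<lambda>\<omega>. exp (Z 1 \<omega> powr \<alpha>))"
  obtains c where "c > 0" "AE \<omega> in M. \<forall>\<^sub>F L in sequentially. c / (real L)\<^sup>2 \<le> gap \<omega> L"
proof -
  define h where "h = (\<lambda>x::real. exp (x powr \<alpha>))"
  have [measurable]: "h \<in> borel_measurable borel" unfolding h_def by measurable
  have hint: "integrable M (\<lambda>\<omega>. h (Z i \<omega>))" for i
  proof -
    have "integrable (distr M borel (Z i)) h \<longleftrightarrow> integrable M (\<lambda>\<omega>. h (Z i \<omega>))" for i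
      using iid_rv[OF iid_Z] by (intro integrable_distr_eq) auto
    moreover have "distr M borel (Z i) = distr M borel (Z 1)" using iid_Z unfolding iid_def by blast
    ultimately show ?thesis using exp_moment unfolding h_def by metis
  qed
  define C where "C = max 1 (max (expectation (\<lambda>\<omega>. h (Z 0 \<omega>)) + 1) (expectation (\<lambda>\<omega>. h (Z (- 1) \<omega>)) + 1))"
  have C: "C \<ge> 1" by (simp add: C_def)
  have "AE \<omega> in M. \<forall>\<^sub>F n in sequentially. (\<Sum>i<n. h (Z (int i) \<omega>)) \<le> C * real n"
    "AE \<omega> in M. \<forall>\<^sub>F n in sequentially. (\<Sum>i<n. h (Z (- 1 - int i) \<omega>)) \<le> C * real n"
    using hint by (intro iid_transform_linear iid_right iid_left; simp add: C_def)+
  moreover have "AE \<omega> in M. \<forall>\<^sub>F L :: nat in sequentially.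
      {k. \<bar>real_of_int k\<bar> \<le> 1 / 2 * L / (2 * \<mu>)} \<subseteq> box_index (\<lambda>i. Z i \<omega>) L \<and>
      box_index (\<lambda>i. Z i \<omega>) L \<subseteq> {- int (width L)..int (width L)}"
    using AE_box_index[of "1 / 2"] by simp
  ultimately have "AE \<omega> in M. \<forall>\<^sub>F L in sequentially. \<mu>\<^sup>2 / (6 * C) / (real L)\<^sup>2 \<le> gap \<omega> L"
    using AE_pos
  proof eventually_elim
    case (elim \<omega>)
    obtain N where N: "(\<Sum>i<n. h (Z (int i) \<omega>)) \<le> C * real n" "(\<Sum>i<n. h (Z (- 1 - int i) \<omega>)) \<le> C * real n" if "n \<ge> N" for n
      using eventually_conj[OF elim(1,2)] unfolding eventually_sequentially by blast
    have z: "\<And>i. Z i \<omega> > 0" using elim by blast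
    have "\<forall>\<^sub>F L :: nat in sequentially. max 1 (real N) \<le> 1 / \<mu> * L" "\<forall>\<^sub>F L :: nat in sequentially. 1 \<le> 1 / (4 * \<mu>) * L"
      using mean_pos by (intro eventually_le_mult_nat; simp)+
    with elim(3) show ?case
    proof eventually_elim
      case (elim L)
      define m where "m = width L"
      have Lm: "max 1 (real N) \<le> L / \<mu>" using elim by simp
      have m: "real m \<le> L / \<mu>" unfolding m_def using Lm by (intro of_nat_floor) simp
      have m1: "N \<le> m" "1 \<le> m" unfolding m_def using Lm by (auto intro!: le_nat_floor)
      have R: "(\<Sum>k\<in>{- int m..<int m}. exp (Z k \<omega> powr \<alpha>)) \<le> 2 * C * real m"
        using N[OF m1(1)] unfolding sum_two_sided h_def by simp
      \<comment> \<open>Two points in the box make the supremum one over a nonempty set.\<close>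
      have "\<bar>real_of_int k\<bar> \<le> 1 / 2 * L / (2 * \<mu>)" if "k \<in> {0, 1}" for k using that elim by (auto simp: field_simps)
      then have "0 \<in> box_index (\<lambda>i. Z i \<omega>) L" "1 \<in> box_index (\<lambda>i. Z i \<omega>) L" using elim by blast+
      from spectral_gap_ge_path[OF z \<alpha> _ this R] elim
      have g: "1 / ((2 * real m + 1) * (2 * C * real m)) \<le> gap \<omega> L" unfolding m_def by simp
      have "(2 * real m + 1) * (2 * C * real m) \<le> (3 * (L / \<mu>)) * (2 * C * (L / \<mu>))"
        using m C Lm by (intro mult_mono) auto
      then have "1 / ((3 * (L / \<mu>)) * (2 * C * (L / \<mu>))) \<le> 1 / ((2 * real m + 1) * (2 * C * real m))"
        using m1 C by (intro frac_le mult_pos_pos) auto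
      also note g
      also have "1 / ((3 * (L / \<mu>)) * (2 * C * (L / \<mu>))) = \<mu>\<^sup>2 / (6 * C) / (real L)\<^sup>2"
        by (simp add: power2_eq_square field_simps)
      finally show ?case .
    qed
  qed
  then show ?thesis using C mean_pos by (intro that[of "\<mu>\<^sup>2 / (6 * C)"]) auto
qed

text \<open>Among order \<open>L\<close> points the variance of \<open>x\<^sub>k \<mapsto> k\<close> is of order \<open>L\<^sup>4\<close>, and its energy is at most of order \<open>L\<close>.\<close>

lemma gap_le_inverse_square:
  obtains c where "c > 0" "AE \<omega> in M. \<forall>\<^sub>F L in sequentially. gap \<omega> L \<le> c / (real L)\<^sup>2"
proof -
  obtain Cr where Cr: "Cr > 0"
    "AE \<omega> in M. \<forall>\<^sub>F n in sequentially. (\<Sum>k<n. \<Sum>d<n. jump_energy \<alpha> (\<lambda>i. Z (int (i + k)) \<omega>) d) \<le> Cr * real n"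
    using jump_energy_linear[OF iid_right pos \<alpha>] by blast
  obtain Cl where Cl: "Cl > 0"
    "AE \<omega> in M. \<forall>\<^sub>F n in sequentially. (\<Sum>k<n. \<Sum>d<n. jump_energy \<alpha> (\<lambda>i. Z (- 1 - int (i + k)) \<omega>) d) \<le> Cl * real n"
    using jump_energy_linear[OF iid_left pos \<alpha>] by blast
  define D where "D = 4 * Cr / \<mu> + 4 * Cl / \<mu> + 1"
  have D: "D > 0" unfolding D_def using Cr(1) Cl(1) mean_pos by (intro add_pos_pos) auto
  have low: "AE \<omega> in M. \<forall>\<^sub>F n in sequentially. (\<Sum>i<n. - Z (int i) \<omega>) \<le> - (\<mu> / 2) * real n"
    "AE \<omega> in M. \<forall>\<^sub>F n in sequentially. (\<Sum>i<n. - Z (- 1 - int i) \<omega>) \<le> - (\<mu> / 2) * real n"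
    using int mean mean_pos
    by (intro iid_transform_linear[OF iid_right, of "\<lambda>x. - x"] iid_transform_linear[OF iid_left, of "\<lambda>x. - x"]; simp)+
  have box: "AE \<omega> in M. \<forall>\<^sub>F L :: nat in sequentially.
      {k. \<bar>real_of_int k\<bar> \<le> 1 / 2 * L / (2 * \<mu>)} \<subseteq> box_index (\<lambda>i. Z i \<omega>) L \<and>
      box_index (\<lambda>i. Z i \<omega>) L \<subseteq> {- int (width L)..int (width L)}"
    using AE_box_index[of "1 / 2"] by simp
  define c where "c = 3 * 16 ^ 4 * D * \<mu> ^ 3"
  have "AE \<omega> in M. \<forall>\<^sub>F L in sequentially. gap \<omega> L \<le> c / (real L)\<^sup>2"
    using Cr(2) Cl(2) low box AE_pos
  proof eventually_elim
    case (elim \<omega>)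
    have z: "\<And>i. Z i \<omega> > 0" using elim by blast
    define s t where "s = (\<lambda>i. Z (int i) \<omega>)" and "t = (\<lambda>i. Z (- 1 - int i) \<omega>)"
    have S: "summable (tail_weight \<alpha> s)" "summable (tail_weight \<alpha> t)"
      using elim(3,4) mean_pos \<alpha> by (intro tail_weight_summable[of "\<mu> / 2"]; simp add: s_def t_def sum_negf)+
    define Q where "Q = 2 * suminf (tail_weight \<alpha> s) * suminf (tail_weight \<alpha> t)"
    obtain N where N: "(\<Sum>k<n. \<Sum>d<n. jump_energy \<alpha> (\<lambda>i. s (i + k)) d) \<le> Cr * real n"
      "(\<Sum>k<n. \<Sum>d<n. jump_energy \<alpha> (\<lambda>i. t (i + k)) d) \<le> Cl * real n" if "n \<ge> N" for n
      using eventually_conj[OF elim(1,2)] unfolding eventually_sequentially s_def t_def by blast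
    have "\<forall>\<^sub>F L :: nat in sequentially. max 1 (real N) \<le> 1 / \<mu> * L" "\<forall>\<^sub>F L :: nat in sequentially. Q \<le> 1 * L"
      "\<forall>\<^sub>F L :: nat in sequentially. 1 \<le> 1 / (16 * \<mu>) * L"
      using mean_pos by (intro eventually_le_mult_nat; simp)+
    with elim(5) show ?case
    proof eventually_elim
      case (elim L)
      define m where "m = width L"
      define q where "q = nat \<lfloor>real L / (8 * \<mu>)\<rfloor>"
      have Lm: "max 1 (real N) \<le> L / \<mu>" using elim by simp
      then have L0: "0 < real L" using mean_pos by (cases "L = 0") auto
      have m: "real m \<le> L / \<mu>" unfolding m_def using Lm by (intro of_nat_floor) simp
      have m3: "2 * real m + 1 \<le> 3 * (L / \<mu>)" using m Lm by linarith
      have "N \<le> m" unfolding m_def using Lm by (auto intro!: le_nat_floor)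
      then have "N \<le> Suc m" by simp
      have q: "real q \<le> L / (8 * \<mu>)" unfolding q_def using L0 mean_pos by (intro of_nat_floor) simp
      have one: "1 \<le> L / (16 * \<mu>)" using elim(4) by simp
      have q': "L / (16 * \<mu>) \<le> real q"
      proof -
        have "L / (8 * \<mu>) - 1 \<le> real q" unfolding q_def by linarith
        moreover have "L / (8 * \<mu>) = 2 * (L / (16 * \<mu>))" by simp
        ultimately show ?thesis using one by linarith
      qed
      have q0: "0 < q" using q' one by linarith
      have "{- int (2 * q)..int (2 * q)} \<subseteq> {k. \<bar>real_of_int k\<bar> \<le> 1 / 2 * L / (2 * \<mu>)}"
      proof
        fix k assume "k \<in> {- int (2 * q)..int (2 * q)}"
        then have "\<bar>real_of_int k\<bar> \<le> 2 * real q" by auto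
        also have "\<dots> \<le> 2 * (L / (8 * \<mu>))" using q by simp
        finally show "k \<in> {k. \<bar>real_of_int k\<bar> \<le> 1 / 2 * L / (2 * \<mu>)}" by simp
      qed
      then have I: "{- int (2 * q)..int (2 * q)} \<subseteq> box_index (\<lambda>i. Z i \<omega>) L" using elim by blast
      have "gap \<omega> L \<le> (2 * real m + 1) * (2 * (Cr * real (Suc m)) + 2 * (Cl * real (Suc m)) + Q) / real q ^ 4"
        unfolding Q_def s_def t_def
      proof (rule spectral_gap_le_linear[OF z \<alpha> _ I q0])
        show "box_index (\<lambda>i. Z i \<omega>) L \<subseteq> {- int m..int m}" using elim(1) unfolding m_def by blast
      qed (use N[OF \<open>N \<le> Suc m\<close>] S in \<open>simp_all only: s_def t_def\<close>)
      also have "\<dots> \<le> (3 * (L / \<mu>)) * (D * L) / (L / (16 * \<mu>)) ^ 4"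
      proof (intro frac_le mult_mono)
        have "real (Suc m) \<le> 2 * (L / \<mu>)" using m Lm by simp
        then have "Cr * real (Suc m) \<le> Cr * (2 * (L / \<mu>))" "Cl * real (Suc m) \<le> Cl * (2 * (L / \<mu>))"
          using Cr(1) Cl(1) by (intro mult_left_mono; simp)+
        moreover have "D * L = 2 * (Cr * (2 * (L / \<mu>))) + 2 * (Cl * (2 * (L / \<mu>))) + L"
          by (simp add: D_def algebra_simps add_divide_distrib)
        ultimately show "2 * (Cr * real (Suc m)) + 2 * (Cl * real (Suc m)) + Q \<le> D * L"
          using elim by linarith
        have "0 \<le> Q" unfolding Q_def using S by (simp add: suminf_nonneg tail_weight_nonneg)
        then show "0 \<le> 2 * (Cr * real (Suc m)) + 2 * (Cl * real (Suc m)) + Q"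
          using Cr(1) Cl(1) by simp
        show "(L / (16 * \<mu>)) ^ 4 \<le> real q ^ 4" using q' L0 mean_pos by (intro power_mono) auto
        show "2 * real m + 1 \<le> 3 * (L / \<mu>)" by (rule m3)
      qed (use L0 mean_pos D in auto)
      also have "\<dots> = c / (real L)\<^sup>2"
        using L0 mean_pos by (simp add: c_def field_simps power2_eq_square power3_eq_cube power4_eq_xxxx)
      finally show ?case .
    qed
  qed
  moreover have "c > 0" using D mean_pos by (simp add: c_def)
  ultimately show ?thesis by (intro that)
qed

end

section \<open>The largest spacing in the box\<close>

lemma int_decode_bound: "2 * \<bar>int_decode n\<bar> \<le> int n + 1"
proof (cases "even n")
  case True
  then show ?thesis by (auto simp: int_decode_def sum_decode_def elim!: evenE)
next
  case False
  then show ?thesis by (auto simp: int_decode_def sum_decode_def elim!: oddE)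
qed

context renewal_environment
begin

text \<open>The bijection \<open>int_decode\<close> enumerates the integers outwards from \<open>0\<close>, alternating between the two
  sides. It turns the two-sided window of about \<open>n\<close> spacings around the origin into the first \<open>n\<close> terms of
  a one-sided sequence, so that no factor two is lost.\<close>

lemma AE_large_gap:
  fixes b :: "real \<Rightarrow> real"
  assumes \<psi>: "\<And>t. \<psi> t = prob {\<omega> \<in> space M. Z 0 \<omega> > t}"
    and b: "mono_on {0..} b"
    and inf: "filterlim (\<lambda>n :: nat. real n * \<psi> (b (real n))) at_top sequentially"
    and sum: "summable (\<lambda>n :: nat. \<psi> (b (real n)) * exp (- (real n * \<psi> (b (real n)))))"
  shows "AE \<omega> in M. \<forall>\<^sub>F n :: nat in sequentially. \<exists>c. 2 * \<bar>c\<bar> \<le> int n \<and> Z c \<omega> > b (real n)"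
proof -
  have iid: "iid (\<lambda>n. Z (int_decode n))" by (rule iid_reindex[OF iid_Z]) (rule inj_int_decode)
  have 0: "int_decode 0 = 0" by (simp add: int_decode_def sum_decode_def)
  have "incseq (\<lambda>n::nat. b (real n))" using b by (auto simp: incseq_def mono_on_def)
  from iid_max_exceeds[OF iid this, of \<psi>] \<psi> inf sum
  have "AE \<omega> in M. \<forall>\<^sub>F n :: nat in sequentially. \<exists>i<n. Z (int_decode i) \<omega> > b (real n)" by (simp add: 0)
  then show ?thesis
  proof eventually_elim
    case (elim \<omega>)
    then show ?case
    proof eventually_elim
      case (elim n)
      then obtain i where i: "i < n" "Z (int_decode i) \<omega> > b (real n)" by blast
      then show ?case using int_decode_bound[of i] by (intro exI[of _ "int_decode i"]) linarith
    qed
  qed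
qed

text \<open>About \<open>\<gamma> L / \<mu>\<close> spacings around the origin contain one larger than \<open>b (\<gamma> L / \<mu>)\<close>. Since \<open>\<gamma> < 1\<close>, they
  occupy only a fraction of the box, so a cut there leaves order \<open>L\<close> points of the box on
  either side.\<close>

lemma gap_le_of_windows:
  fixes b :: "real \<Rightarrow> real" and l :: "nat \<Rightarrow> nat"
  defines "d \<equiv> min 1 (3 powr (\<alpha> - 1))"
  assumes \<psi>: "\<And>t. \<psi> t = prob {\<omega> \<in> space M. Z 0 \<omega> > t}"
    and b0: "\<forall>t\<ge>0. b t \<ge> 0" and b: "mono_on {0..} b"
    and inf: "filterlim (\<lambda>n :: nat. real n * \<psi> (b (real n))) at_top sequentially"
    and sum: "summable (\<lambda>n :: nat. \<psi> (b (real n)) * exp (- (real n * \<psi> (b (real n)))))"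
    and \<gamma>: "0 < \<gamma>" "\<gamma> < 1" and \<delta>: "\<delta> > 0"
    and windows: "AE \<omega> in M. \<forall>\<^sub>F L :: nat in sequentially.
      0 < l L \<and> (\<forall>k\<in>{- int (L\<^sup>2)..int (L\<^sup>2)}. \<exists>i\<in>{k..<k + int (l L)}. Z i \<omega> > \<delta>)"
  obtains C where "C > 0" "AE \<omega> in M. \<forall>\<^sub>F L :: nat in sequentially.
    gap \<omega> L \<le> C * (real (l L))\<^sup>2 * (exp (- (d * b (\<gamma> * real L / \<mu>) powr \<alpha>)) / real L)"
proof -
  define \<theta> where "\<theta> = (1 + \<gamma>) / 2"
  have \<theta>: "0 < \<theta>" "\<theta> < 1" "\<gamma> < \<theta>" using \<gamma> by (auto simp: \<theta>_def)
  \<comment> \<open>On each side there is room for \<open>(\<theta> - \<gamma>) L / (2 \<mu>) = 2 \<eta> L\<close> points outside the searched window: half of them is claimed, the other half absorbs the rounding errors, which add up to at most \<open>5 / 2\<close>.\<close>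
  define \<eta> where "\<eta> = (\<theta> - \<gamma>) / (4 * \<mu>)"
  have \<eta>: "\<eta> > 0" using \<theta> mean_pos by (simp add: \<eta>_def)
  define H where "H = (\<Sum>n. exp (- (d * (\<delta> * real n) powr \<alpha>)))"
  \<comment> \<open>The summand 1 makes the constant visibly positive.\<close>
  define C where "C = 4 / \<eta> * H\<^sup>2 + 1"
  have "C > 0" using \<eta> by (simp add: C_def add_nonneg_pos)
  moreover have "AE \<omega> in M. \<forall>\<^sub>F L :: nat in sequentially.
    gap \<omega> L \<le> C * (real (l L))\<^sup>2 * (exp (- (d * b (\<gamma> * real L / \<mu>) powr \<alpha>)) / real L)"
    using AE_box_index[OF \<theta>(1,2)] AE_large_gap[OF \<psi> b inf sum] windows AE_pos
  proof eventually_elim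
    case (elim \<omega>)
    have z: "\<And>i. Z i \<omega> > 0" using elim by blast
    obtain N where N: "\<And>n. n \<ge> N \<Longrightarrow> \<exists>c. 2 * \<bar>c\<bar> \<le> int n \<and> Z c \<omega> > b (real n)"
      using elim(2) unfolding eventually_sequentially by blast
    have "\<forall>\<^sub>F L :: nat in sequentially. real N \<le> \<gamma> / \<mu> * L" "\<forall>\<^sub>F L :: nat in sequentially. 5 / 2 \<le> \<eta> * L"
      "\<forall>\<^sub>F L :: nat in sequentially. 1 / \<mu> \<le> 1 * L"
      using \<gamma> mean_pos \<eta> by (intro eventually_le_mult_nat; simp)+
    with elim(1,3) show ?case using eventually_ge_at_top[of 1]
    proof eventually_elim
      case (elim L)
      define n where "n = nat \<lceil>\<gamma> * real L / \<mu>\<rceil>"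
      define m where "m = width L"
      define p where "p = nat \<lfloor>\<theta> * real L / (2 * \<mu>)\<rfloor>"
      define q where "q = nat \<lfloor>\<eta> * real L\<rfloor>"
      have L1: "1 \<le> real L" using elim by simp
      have t0: "0 \<le> \<gamma> * real L / \<mu>" using \<gamma> mean_pos by simp
      have n: "\<gamma> * real L / \<mu> \<le> real n" "real n \<le> \<gamma> * real L / \<mu> + 1"
        unfolding n_def using t0 by linarith+
      have "N \<le> n" using n(1) elim by simp
      then obtain c where c: "2 * \<bar>c\<bar> \<le> int n" "Z c \<omega> > b (real n)" using N by blast
      have p: "\<theta> * real L / (2 * \<mu>) - 1 \<le> real p" "real p \<le> \<theta> * real L / (2 * \<mu>)"
        unfolding p_def using \<theta> mean_pos by (linarith, intro of_nat_floor, simp)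
      have q: "\<eta> * real L - 1 \<le> real q" "real q \<le> \<eta> * real L"
        unfolding q_def using \<eta> by (linarith, intro of_nat_floor, simp)
      have q': "\<eta> * real L / 2 \<le> real q" using q elim by linarith
      have qpos: "0 < \<eta> * real L / 2" using \<eta> L1 by simp
      have q0: "0 < q" using q' qpos by linarith
      define g where "g = \<gamma> * real L / \<mu>"
      have split: "\<theta> * real L / (2 * \<mu>) = g / 2 + 2 * (\<eta> * real L)"
        using mean_pos by (simp add: \<eta>_def g_def field_simps)
      have slack: "5 / 2 \<le> \<eta> * real L" using elim by simp
      have "2 * real_of_int \<bar>c\<bar> \<le> real n" using c(1) by linarith
      then have "real_of_int \<bar>c\<bar> + real q + 1 \<le> real p"
        using n(2)[folded g_def] p(1) q(2) slack unfolding split by linarith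
      then have cq: "\<bar>c\<bar> + int q + 1 \<le> int p" by linarith
      have "{- int p..int p} \<subseteq> {k. \<bar>real_of_int k\<bar> \<le> \<theta> * L / (2 * \<mu>)}"
      proof
        fix k assume "k \<in> {- int p..int p}"
        then have "\<bar>real_of_int k\<bar> \<le> real p" by auto
        with p(2) show "k \<in> {k. \<bar>real_of_int k\<bar> \<le> \<theta> * L / (2 * \<mu>)}" by simp
      qed
      then have I: "{- int p..int p} \<subseteq> box_index (\<lambda>i. Z i \<omega>) L" using elim by blast
      have "real m \<le> real L / \<mu>" unfolding m_def using mean_pos by (intro of_nat_floor) simp
      also have "\<dots> \<le> real L * real L" using elim mult_left_mono[of "1 / \<mu>" "real L" "real L"] by simp
      also have "\<dots> = real (L\<^sup>2)" by (simp add: power2_eq_square)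
      finally have "real m \<le> real (L\<^sup>2)" .
      then have mL: "int m \<le> int (L\<^sup>2)" unfolding of_nat_le_iff .
      have win: "\<exists>i\<in>{k..<k + int (l L)}. Z i \<omega> > \<delta>" if "k \<in> {- int m..int m}" for k
      proof -
        have "k \<in> {- int (L\<^sup>2)..int (L\<^sup>2)}" using that mL unfolding atLeastAtMost_iff by linarith
        then show ?thesis using elim by blast
      qed
      have "gap \<omega> L \<le> 2 / real q * (real (l L) * H)\<^sup>2 * exp (- (d * Z c \<omega> powr \<alpha>))"
        unfolding H_def d_def
      proof (rule spectral_gap_le_cut[where m = m, OF z \<alpha> \<delta> _ _ _ I cq q0])
        show "0 < l L" using elim by blast
        show "box_index (\<lambda>i. Z i \<omega>) L \<subseteq> {- int m..int m}" using elim unfolding m_def by blast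
      qed (rule win)
      also have "\<dots> \<le> (4 / \<eta> / real L) * (real (l L) * H)\<^sup>2 * exp (- (d * b (\<gamma> * real L / \<mu>) powr \<alpha>))"
      proof (intro mult_mono)
        have "2 / real q \<le> 2 / (\<eta> * real L / 2)"
          using q' qpos by (intro divide_left_mono mult_pos_pos) auto
        then show "2 / real q \<le> 4 / \<eta> / real L" by (simp add: field_simps)
        have "b (\<gamma> * real L / \<mu>) \<le> b (real n)" using b n(1) t0 by (auto simp: mono_on_def)
        also have "\<dots> \<le> Z c \<omega>" using c by simp
        finally have "b (\<gamma> * real L / \<mu>) powr \<alpha> \<le> Z c \<omega> powr \<alpha>"
          using b0 t0 \<alpha> by (intro powr_mono2) auto
        then show "exp (- (d * Z c \<omega> powr \<alpha>)) \<le> exp (- (d * b (\<gamma> * real L / \<mu>) powr \<alpha>))"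
          by (simp add: d_def mult_left_mono)
      qed (use \<eta> in auto)
      also have "\<dots> = (4 / \<eta> * H\<^sup>2) * ((real (l L))\<^sup>2 * (exp (- (d * b (\<gamma> * real L / \<mu>) powr \<alpha>)) / real L))"
        by (simp add: power_mult_distrib mult_ac)
      also have "\<dots> \<le> C * ((real (l L))\<^sup>2 * (exp (- (d * b (\<gamma> * real L / \<mu>) powr \<alpha>)) / real L))"
        by (intro mult_right_mono) (auto simp: C_def)
      finally show ?case by (simp add: mult.assoc)
    qed
  qed
  ultimately show ?thesis by (intro that)
qed

text \<open>Spacings are positive, hence exceed some \<open>\<delta>\<close> with positive probability.\<close>

lemma log_windows:
  obtains \<delta> K :: real where "\<delta> > 0" "K > 0"
    "AE \<omega> in M. \<forall>\<^sub>F L :: nat in sequentially. 0 < nat \<lceil>K * ln (real L)\<rceil> \<and>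
      (\<forall>k\<in>{- int (L\<^sup>2)..int (L\<^sup>2)}. \<exists>i\<in>{k..<k + int (nat \<lceil>K * ln (real L)\<rceil>)}. Z i \<omega> > \<delta>)"
proof -
  obtain \<delta> where \<delta>: "\<delta> > 0" "prob {\<omega> \<in> space M. Z 0 \<omega> \<le> \<delta>} < 1"
    using positive_exceeds_level[OF iid_rv[OF iid_Z] pos] by blast
  \<comment> \<open>The probability itself may be \<open>0\<close>, where the logarithm is of no use.\<close>
  define p where "p = max (1 / 2) (prob {\<omega> \<in> space M. Z 0 \<omega> \<le> \<delta>})"
  have p: "prob {\<omega> \<in> space M. Z 0 \<omega> \<le> \<delta>} \<le> p" "0 < p" "p < 1" using \<delta>(2) by (auto simp: p_def)
  define K where "K = 4 / (- ln p)"
  have K: "K > 0" unfolding K_def using p by (intro divide_pos_pos) auto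
  have "AE \<omega> in M. \<forall>\<^sub>F L :: nat in sequentially. 0 < nat \<lceil>K * ln (real L)\<rceil> \<and>
      (\<forall>k\<in>{- int (L\<^sup>2)..int (L\<^sup>2)}. \<exists>i\<in>{k..<k + int (nat \<lceil>K * ln (real L)\<rceil>)}. Z i \<omega> > \<delta>)"
    using iid_log_windows[OF iid_Z p]
  proof eventually_elim
    case (elim \<omega>)
    then show ?case using eventually_ge_at_top[of 2]
    proof eventually_elim
      case (elim L)
      have "0 < K * ln (real L)" using K elim by (intro mult_pos_pos) auto
      with elim show ?case unfolding K_def by simp
    qed
  qed
  with \<delta>(1) K show ?thesis by (rule that)
qed

end

theorem corollary1p5:
  fixes M :: "'a measure"
    and Z :: "int \<Rightarrow> 'a \<Rightarrow> real"
    and \<alpha> \<mu> :: real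
    and \<psi> :: "real \<Rightarrow> real"
  assumes "prob_space M"
    and "\<alpha> > 0"
    and "prob_space.indep_vars M (\<lambda>_. borel) Z UNIV"
    and "\<And>i j. distr M borel (Z i) = distr M borel (Z j)"
    and "\<And>i. AE \<omega> in M. Z i \<omega> > 0"
    and "\<And>i. integrable M (Z i)"
    and "\<And>i. prob_space.expectation M (Z i) = \<mu>"
    and "\<And>i t. \<psi> t = measure M {\<omega> \<in> space M. Z i \<omega> > t}"
  shows
    "(integrable M (\<lambda>\<omega>. exp (Z 1 \<omega> powr \<alpha>)) \<longrightarrow>
       (\<exists>c1 > 0. \<exists>c2 > 0. AE \<omega> in M. \<forall>\<^sub>F L :: nat in sequentially.
          c1 / (real L)\<^sup>2 \<le> spectral_gap \<alpha> (renewal_set (\<lambda>i. Z i \<omega>)) (real L) \<and>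
          spectral_gap \<alpha> (renewal_set (\<lambda>i. Z i \<omega>)) (real L) \<le> c2 / (real L)\<^sup>2))
     \<and>
     (\<forall>b :: real \<Rightarrow> real.
        (\<forall>t \<ge> 0. b t \<ge> 0) \<longrightarrow>
        mono_on {0..} b \<longrightarrow>
        (\<lambda>n :: nat. \<psi> (b (real n))) \<longlonglongrightarrow> 0 \<longrightarrow>
        filterlim (\<lambda>n :: nat. real n * \<psi> (b (real n))) at_top sequentially \<longrightarrow>
        summable (\<lambda>n :: nat. \<psi> (b (real n)) * exp (- (real n * \<psi> (b (real n))))) \<longrightarrow>
        (\<forall>\<gamma> \<in> {0<..<1}.
           (\<exists>C > 0. AE \<omega> in M. \<forall>\<^sub>F L :: nat in sequentially.
              spectral_gap \<alpha> (renewal_set (\<lambda>i. Z i \<omega>)) (real L)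
                \<le> C * (ln (real L))\<^sup>2 *
                   (exp (- (min 1 (3 powr (\<alpha> - 1)) * b (\<gamma> * real L / \<mu>) powr \<alpha>)) / real L)) \<and>
           ((\<exists>\<delta> > 0. \<forall>i. measure M {\<omega> \<in> space M. Z i \<omega> \<le> \<delta>} = 0) \<longrightarrow>
            (\<exists>C > 0. AE \<omega> in M. \<forall>\<^sub>F L :: nat in sequentially.
              spectral_gap \<alpha> (renewal_set (\<lambda>i. Z i \<omega>)) (real L)
                \<le> C * (exp (- (min 1 (3 powr (\<alpha> - 1)) * b (\<gamma> * real L / \<mu>) powr \<alpha>)) / real L)))))"
proof -
  interpret prob_space M by fact
  interpret renewal_environment M Z \<alpha> \<mu>
    by unfold_locales (use assms in \<open>auto simp: iid_def\<close>)
  let ?rate = "\<lambda>b \<gamma> L. exp (- (min 1 (3 powr (\<alpha> - 1)) * b (\<gamma> * real L / \<mu>) powr \<alpha>)) / real L"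
  show ?thesis
  proof (intro conjI impI allI ballI)
    assume m: "integrable M (\<lambda>\<omega>. exp (Z 1 \<omega> powr \<alpha>))"
    obtain c1 where c1: "c1 > 0" "AE \<omega> in M. \<forall>\<^sub>F L in sequentially. c1 / (real L)\<^sup>2 \<le> gap \<omega> L"
      using gap_ge_inverse_square[OF m] by blast
    obtain c2 where c2: "c2 > 0" "AE \<omega> in M. \<forall>\<^sub>F L in sequentially. gap \<omega> L \<le> c2 / (real L)\<^sup>2"
      using gap_le_inverse_square by blast
    from c1(2) c2(2) have "AE \<omega> in M. \<forall>\<^sub>F L in sequentially. c1 / (real L)\<^sup>2 \<le> gap \<omega> L \<and> gap \<omega> L \<le> c2 / (real L)\<^sup>2"
      by eventually_elim (rule eventually_conj)
    then show "\<exists>c1 > 0. \<exists>c2 > 0. AE \<omega> in M. \<forall>\<^sub>F L :: nat in sequentially.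
          c1 / (real L)\<^sup>2 \<le> gap \<omega> L \<and> gap \<omega> L \<le> c2 / (real L)\<^sup>2"
      using c1(1) c2(1) by blast
  next
    fix b :: "real \<Rightarrow> real" and \<gamma> :: real
    assume b: "\<forall>t\<ge>0. b t \<ge> 0" "mono_on {0..} b"
      and inf: "filterlim (\<lambda>n :: nat. real n * \<psi> (b (real n))) at_top sequentially"
      and sum: "summable (\<lambda>n :: nat. \<psi> (b (real n)) * exp (- (real n * \<psi> (b (real n)))))"
      and \<gamma>: "\<gamma> \<in> {0<..<1}"
    have \<gamma>': "0 < \<gamma>" "\<gamma> < 1" using \<gamma> by auto
    note upper = gap_le_of_windows[where b = b and \<psi> = \<psi>, OF assms(8) b(1) b(2) inf sum \<gamma>']
    show "\<exists>C > 0. AE \<omega> in M. \<forall>\<^sub>F L :: nat in sequentially. gap \<omega> L \<le> C * (ln (real L))\<^sup>2 * ?rate b \<gamma> L"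
    proof -
      obtain \<delta> K :: real where \<delta>: "\<delta> > 0" and K: "K > 0"
        and win: "AE \<omega> in M. \<forall>\<^sub>F L :: nat in sequentially. 0 < nat \<lceil>K * ln (real L)\<rceil> \<and>
          (\<forall>k\<in>{- int (L\<^sup>2)..int (L\<^sup>2)}. \<exists>i\<in>{k..<k + int (nat \<lceil>K * ln (real L)\<rceil>)}. Z i \<omega> > \<delta>)"
        by (rule log_windows)
      obtain C where C: "C > 0"
        "AE \<omega> in M. \<forall>\<^sub>F L :: nat in sequentially. gap \<omega> L \<le> C * (real (nat \<lceil>K * ln (real L)\<rceil>))\<^sup>2 * ?rate b \<gamma> L"
        using upper[OF \<delta> win] by blast
      have ln: "\<forall>\<^sub>F L :: nat in sequentially. 1 \<le> ln (real L)" by real_asymp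
      from C(2) have "AE \<omega> in M. \<forall>\<^sub>F L :: nat in sequentially. gap \<omega> L \<le> (C * (K + 1)\<^sup>2) * (ln (real L))\<^sup>2 * ?rate b \<gamma> L"
      proof eventually_elim
        case (elim \<omega>)
        from elim ln show ?case
        proof eventually_elim
          case (elim L)
          have "0 \<le> K * ln (real L)" using K elim by simp
          then have "real (nat \<lceil>K * ln (real L)\<rceil>) \<le> K * ln (real L) + 1" by linarith
          also have "\<dots> \<le> (K + 1) * ln (real L)" using elim by (simp add: algebra_simps)
          finally have "(real (nat \<lceil>K * ln (real L)\<rceil>))\<^sup>2 \<le> ((K + 1) * ln (real L))\<^sup>2" by (intro power_mono) auto
          then have "C * (real (nat \<lceil>K * ln (real L)\<rceil>))\<^sup>2 * ?rate b \<gamma> L \<le> C * ((K + 1) * ln (real L))\<^sup>2 * ?rate b \<gamma> L"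
            using C(1) by (intro mult_right_mono mult_left_mono) auto
          with elim show ?case by (simp add: power_mult_distrib mult.assoc)
        qed
      qed
      moreover have "C * (K + 1)\<^sup>2 > 0" using C(1) K by simp
      ultimately show ?thesis by blast
    qed
    assume "\<exists>\<delta> > 0. \<forall>i. measure M {\<omega> \<in> space M. Z i \<omega> \<le> \<delta>} = 0"
    then obtain \<delta> where \<delta>: "\<delta> > 0" "\<And>i. prob {\<omega> \<in> space M. Z i \<omega> \<le> \<delta>} = 0" by blast
    have "AE \<omega> in M. \<not> Z i \<omega> \<le> \<delta>" for i
      using \<delta>(2)[of i] iid_rv[OF iid_Z, of i] by (subst (asm) prob_Collect_eq_0) auto
    then have "AE \<omega> in M. \<forall>i. \<not> Z i \<omega> \<le> \<delta>" by (simp add: AE_all_countable)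
    then have win: "AE \<omega> in M. \<forall>\<^sub>F L :: nat in sequentially. 0 < (1::nat) \<and>
        (\<forall>k\<in>{- int (L\<^sup>2)..int (L\<^sup>2)}. \<exists>i\<in>{k..<k + int 1}. Z i \<omega> > \<delta>)"
    proof eventually_elim
      case (elim \<omega>)
      then have "\<exists>i\<in>{k..<k + int 1}. Z i \<omega> > \<delta>" for k by (intro bexI[of _ k]) (auto simp: not_le)
      then show ?case by (intro always_eventually allI conjI ballI zero_less_one)
    qed
    obtain C where "C > 0"
      "AE \<omega> in M. \<forall>\<^sub>F L :: nat in sequentially. gap \<omega> L \<le> C * (real 1)\<^sup>2 * ?rate b \<gamma> L"
      using upper[OF \<delta>(1) win] by blast
    then show "\<exists>C > 0. AE \<omega> in M. \<forall>\<^sub>F L :: nat in sequentially. gap \<omega> L \<le> C * ?rate b \<gamma> L"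
      by auto
  qed
qed

end
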